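(* Let $f:\mathbb{R}^d\to\mathbb{R}$ be convex, differentiable, $L$-smooth, and minimized at $x_*\in\mathbb{R}^d$. Let $(x_t,z_t)_{t\ge0}$ be any càdlàg stochastic process, with initial values $x_0,z_0\in\mathbb{R}^d$, of the form $$\mathrm{d}x_t=\eta_t(z_t-x_t)\,\mathrm{d}t-\gamma_t\nabla f(x_t)\,\mathrm{d}N(t),\qquad \mathrm{d}z_t=\eta'_t(x_t-z_t)\,\mathrm{d}t-\gamma'_t\nabla f(x_t)\,\mathrm{d}N(t),$$ where $\eta_t,\eta'_t,\gamma_t,\gamma'_t$ are functions of $t\ge0$ and $\mathrm{d}N(t)=\sum_{k\ge1}\delta_{T_k}(\mathrm{d}t)$ is a Poisson point measure on $\mathbb{R}_{\ge0}$ of intensity $\mathrm{d}t$. With $T_0=0$, put for $k\ge 0$ $$\tilde x_k:=x_{T_k},\qquad \tilde y_k:=x_{T_{k+1}-},\qquad \tilde z_k:=z_{T_k}.$$ Then $$\tilde y_k=\tilde x_k+\tau_k(\tilde z_k-\tilde x_k),\qquad \tilde x_{k+1}=\tilde y_k-\tilde\gamma_k\nabla f(\tilde y_k),\qquad \tilde z_{k+1}=\tilde z_k+\tau'_k(\tilde y_k-\tilde z_k)-\tilde\gamma'_k\nabla f(\tilde y_k),$$ for some random parameters $\tau_k,\tau'_k,\tilde\gamma_k,\tilde\gamma'_k$ (that are functions of $T_k,T_{k+1},\eta_t,\eta'_t,\gamma_t,\gamma'_t$). Moreover: 1. For $\eta_t=\frac2t$, $\eta'_t=0$, $\gamma_t=\frac1L$,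 $\gamma'_t=\frac t{2L}$, one has $\tau_k=1-\big(\frac{T_k}{T_{k+1}}\big)^2$, $\tau'_k=0$, $\tilde\gamma_k=\frac1L$, $\tilde\gamma'_k=\frac{T_{k+1}}{2L}$, and $$\mathbb{E}\big[T_k^2\,(f(\tilde x_k)-f(x_* ))\big]\le 2L\|z_0-x_*\|^2.$$ 2. If $f$ is moreover $\mu$-strongly convex, $\mu>0$, then for $\eta_t=\eta'_t\equiv\sqrt{\frac{\mu}{L}}$, $\gamma_t\equiv\frac1L$, $\gamma'_t\equiv\frac1{\sqrt{\mu L}}$, one has $\tau_k=\frac12\Big(1-\exp\big(-2\sqrt{\tfrac\mu L}(T_{k+1}-T_k)\big)\Big)$, $\tau'_k=\tanh\big(\sqrt{\tfrac\mu L}(T_{k+1}-T_k)\big)$, $\tilde\gamma_k=\frac1L$, $\tilde\gamma'_k=\frac1{\sqrt{\mu L}}$, and $$\mathbb{E}\Big[\exp\Big(\sqrt{\frac\mu L}\,T_k\Big)(f(\tilde x_k)-f(x_* ))\Big]\le f(x_0)-f(x_* )+\frac\mu2\|z_0-x_*\|^2.$$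
   Context: $L$-smooth means $f(y)\le f(x)+\langle\nabla f(x),y-x\rangle+\frac L2\|y-x\|^2$ for all $x,y$; $\mu$-strongly convex means $f(y)\ge f(x)+\langle\nabla f(x),y-x\rangle+\frac\mu2\|y-x\|^2$ for all $x,y$. The times $0<T_1<T_2<\dots$ are such that $T_1,T_2-T_1,T_3-T_2,\dots$ are i.i.d. exponential of rate $1$. The stochastic equation means: the processes are càdlàg (right continuous with left limits); at each $T_k$ ($k\ge1$), $x_{T_k}=x_{T_k-}-\gamma_{T_k}\nabla f(x_{T_k-})$ and $z_{T_k}=z_{T_k-}-\gamma'_{T_k}\nabla f(x_{T_k-})$, with $x_{t-},z_{t-}$ left limits; between these times, $\mathrm{d}x_t=\eta_t(z_t-x_t)\,\mathrm{d}t$, $\mathrm{d}z_t=\eta'_t(x_t-z_t)\,\mathrm{d}t$. The expectation is with respect to the Poisson point process, the only source of randomness.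
   Formalization: The rates are Borel; negative parts of η, η' are locally integrable on [0,∞) (else η=-2/t, η'=0 gives a counterexample); the recursion for z̃ is claimed only if η'≥0 or τ_k≠1, since with η'<0 and τ_k=1 no τ'_k need exist. Items 1 and 2 are unaffected. *)

theory Defs
  imports "HOL-Probability.Probability"
begin

definition grad :: "('a::euclidean_space \<Rightarrow> real) \<Rightarrow> 'a \<Rightarrow> 'a" where
  "grad f x = (THE D. GDERIV f x :> D)"

definition L_smooth :: "real \<Rightarrow> ('a::euclidean_space \<Rightarrow> real) \<Rightarrow> bool" where
  "L_smooth L f \<longleftrightarrow>
    (\<forall>x y. f y \<le> f x + grad f x \<bullet> (y - x) + L / 2 * (norm (y - x))\<^sup>2)"

definition strongly_convex :: "real \<Rightarrow> ('a::euclidean_space \<Rightarrow> real) \<Rightarrow> bool" where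
  "strongly_convex \<mu> f \<longleftrightarrow>
    (\<forall>x y. f y \<ge> f x + grad f x \<bullet> (y - x) + \<mu> / 2 * (norm (y - x))\<^sup>2)"

text \<open>The points \<open>T 1 < T 2 < \<dots>\<close> of a Poisson point measure of unit intensity on the half line,
  together with the convention \<open>T 0 = 0\<close>.\<close>

definition poisson_times :: "'w measure \<Rightarrow> (nat \<Rightarrow> 'w \<Rightarrow> real) \<Rightarrow> bool" where
  "poisson_times M T \<longleftrightarrow>
    prob_space M \<and>
    (\<forall>\<omega>\<in>space M. T 0 \<omega> = 0 \<and> strict_mono (\<lambda>k. T k \<omega>)) \<and>
    prob_space.indep_vars M (\<lambda>_. borel) (\<lambda>k \<omega>. T (Suc k) \<omega> - T k \<omega>) UNIV \<and>
    (\<forall>k. distributed M lborel (\<lambda>\<omega>. T (Suc k) \<omega> - T k \<omega>) (exponential_density 1))"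

definition cadlag :: "(real \<Rightarrow> 'a::t2_space) \<Rightarrow> bool" where
  "cadlag p \<longleftrightarrow>
    (\<forall>t\<ge>0. continuous (at_right t) p) \<and> (\<forall>t>0. \<exists>l. (p \<longlongrightarrow> l) (at_left t))"

definition left_lim :: "(real \<Rightarrow> 'a::t2_space) \<Rightarrow> real \<Rightarrow> 'a" where
  "left_lim p t = Lim (at_left t) p"

text \<open>A single path of the equation. The coefficients need not be continuous, so the differential
  equation between two jumps is read in integrated (Lebesgue) form; where the coefficients are
  continuous this is the same as the pointwise differential equation.\<close>

definition solves_flow ::
  "(real \<Rightarrow> real) \<Rightarrow> (real \<Rightarrow> 'a::euclidean_space) \<Rightarrow> (real \<Rightarrow> 'a) \<Rightarrow> real \<Rightarrow> real \<Rightarrow> bool" where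
  "solves_flow \<eta> p q a b \<longleftrightarrow>
    (\<forall>s t. a \<le> s \<and> s \<le> t \<and> t < b \<longrightarrow>
      (\<lambda>u. \<eta> u *\<^sub>R (q u - p u)) absolutely_integrable_on {s..t} \<and>
      p t - p s = integral {s..t} (\<lambda>u. \<eta> u *\<^sub>R (q u - p u)))"

definition continuized_path ::
  "('a::euclidean_space \<Rightarrow> real) \<Rightarrow> (real \<Rightarrow> real) \<Rightarrow> (real \<Rightarrow> real) \<Rightarrow> (real \<Rightarrow> real) \<Rightarrow> (real \<Rightarrow> real)
    \<Rightarrow> (nat \<Rightarrow> real) \<Rightarrow> (real \<Rightarrow> 'a) \<Rightarrow> (real \<Rightarrow> 'a) \<Rightarrow> bool" where
  "continuized_path f \<eta> \<eta>' \<gamma> \<gamma>' T x z \<longleftrightarrow>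
    (\<forall>k. solves_flow \<eta> x z (T k) (T (Suc k)) \<and> solves_flow \<eta>' z x (T k) (T (Suc k))) \<and>
    (\<forall>k\<ge>1. x (T k) = left_lim x (T k) - \<gamma> (T k) *\<^sub>R grad f (left_lim x (T k)) \<and>
            z (T k) = left_lim z (T k) - \<gamma>' (T k) *\<^sub>R grad f (left_lim x (T k)))"

definition continuized_process ::
  "'w measure \<Rightarrow> (nat \<Rightarrow> 'w \<Rightarrow> real) \<Rightarrow> ('a::euclidean_space \<Rightarrow> real)
    \<Rightarrow> (real \<Rightarrow> real) \<Rightarrow> (real \<Rightarrow> real) \<Rightarrow> (real \<Rightarrow> real) \<Rightarrow> (real \<Rightarrow> real)
    \<Rightarrow> 'a \<Rightarrow> 'a \<Rightarrow> (real \<Rightarrow> 'w \<Rightarrow> 'a) \<Rightarrow> (real \<Rightarrow> 'w \<Rightarrow> 'a) \<Rightarrow> bool" where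
  "continuized_process M T f \<eta> \<eta>' \<gamma> \<gamma>' x0 z0 x z \<longleftrightarrow>
    (\<forall>t\<ge>0. x t \<in> borel_measurable M \<and> z t \<in> borel_measurable M) \<and>
    (\<forall>\<omega>\<in>space M. cadlag (\<lambda>t. x t \<omega>) \<and> cadlag (\<lambda>t. z t \<omega>)) \<and>
    (AE \<omega> in M. x 0 \<omega> = x0 \<and> z 0 \<omega> = z0 \<and>
      continuized_path f \<eta> \<eta>' \<gamma> \<gamma>' (\<lambda>k. T k \<omega>) (\<lambda>t. x t \<omega>) (\<lambda>t. z t \<omega>))"

text \<open>Regularity of the mixing rates: only the negative part has to be locally integrable on the
  closed half line, so \<open>2 / t\<close> and every nonnegative Borel function are allowed.
  Without this condition the flow between two jumps need not be determined by its initial value: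
  for the rates \<open>-2 / t\<close> and \<open>0\<close>, the paths with \<open>x t - z t = t\<^sup>2 *\<^sub>R c\<close> all start from \<open>x 0 = z 0\<close>.\<close>

definition mixing_rate :: "(real \<Rightarrow> real) \<Rightarrow> bool" where
  "mixing_rate \<eta> \<longleftrightarrow>
    \<eta> \<in> borel_measurable borel \<and> (\<forall>b\<ge>0. set_integrable lborel {0..b} (\<lambda>t. max 0 (- \<eta> t)))"

end

theory Submission
  imports Defs
begin

text \<open>Between two jumps the gap \<open>w = z - x\<close> solves the scalar linear equation \<open>w' = - (\<eta> + \<eta>') w\<close>, so
  \<open>w t = decay (\<eta> + \<eta>') s t *\<^sub>R w s\<close> and the increments of \<open>x\<close> and \<open>z\<close> are multiples of \<open>w s\<close>: this gives
  the discrete recursion. For the rates, one takes the Lyapunov functions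
  \<open>t\<^sup>2 (f x - f xs) + 2 L \<parallel>z - xs\<parallel>\<^sup>2\<close> and \<open>exp (c t) (f x - f xs + \<mu>/2 \<parallel>z - xs\<parallel>\<^sup>2)\<close> with \<open>c = sqrt (\<mu> / L)\<close>.
  Convexity and the descent lemma show that the derivative along the flow plus the increment at a jump is
  nonpositive; integrating this against the exponential law of the waiting time, the Lyapunov function of the
  embedded Markov chain does not increase in expectation.\<close>

section \<open>Scalar linear equations\<close>

text \<open>The rate \<open>2 / t\<close> has infinite mass at 0, so the classical formula with the
  exponential of minus the integrated rate is meaningless on the first interval. The remedy is an
  asymmetry: a large positive rate only contracts the gap, and if its integral diverges the gap is
  forced to be 0, whereas uniqueness rests on the negative part. Hence only that part is assumed
  integrable, and 0 is a legitimate decay factor. A second degeneracy comes from writing the move of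
  \<open>z\<close> as a multiple of \<open>y - z\<close> instead of the gap \<open>z - x\<close>:
  the factor relating the two is \<open>1 - \<tau>\<close>, up to sign, and it may vanish. In the
  rate bounds, the state after \<open>k\<close> jumps is a deterministic function of the first
  \<open>k\<close> waiting times, so one step of the chain reduces to a one-dimensional integral
  against the exponential density. As both Lyapunov functions are nonnegative, all expectations can
  be taken as extended nonnegative integrals, and integrability is a consequence of the bound rather
  than an assumption.\<close>

lemma exp_taylor1_bound:
  fixes x :: real
  assumes "\<bar>x\<bar> \<le> 1"
  shows "\<bar>exp x - 1 - x\<bar> \<le> x\<^sup>2"
proof -
  have lo: "0 \<le> exp x - 1 - x"
    using exp_ge_add_one_self[of x] by linarith
  have "exp x \<le> 1 + x + x\<^sup>2"
  proof (cases "x \<ge> 0")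
    case True
    then show ?thesis using exp_bound[of x] assms by simp
  next
    case False
    define y where "y = - x"
    have y: "0 \<le> y" "y \<le> 1" using False assms by (auto simp: y_def)
    \<comment> \<open>The product is \<open>1 + y ^ 3\<close>, so \<open>1 - y + y\<^sup>2\<close>
      dominates the reciprocal of \<open>1 + y\<close> and a fortiori the smaller reciprocal of
      \<open>exp y\<close>.\<close>
    have "1 \<le> (1 - y + y\<^sup>2) * (1 + y)"
      using y by (simp add: algebra_simps power2_eq_square)
    also have "\<dots> \<le> (1 - y + y\<^sup>2) * exp y"
      using exp_ge_add_one_self[of y] y by (intro mult_left_mono) auto
    finally have "1 \<le> (1 - y + y\<^sup>2) * exp y" .
    then have "exp (- y) \<le> 1 - y + y\<^sup>2"
      by (simp add: exp_minus field_simps)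
    then show ?thesis by (simp add: y_def)
  qed
  then show ?thesis using lo by simp
qed

lemma linear_flow_continuous:
  fixes g v :: "real \<Rightarrow> real"
  assumes gv: "(\<lambda>u. g u * v u) absolutely_integrable_on {a..c}"
    and eq: "\<And>s t. a \<le> s \<Longrightarrow> s \<le> t \<Longrightarrow> t \<le> c \<Longrightarrow> v t - v s = - integral {s..t} (\<lambda>u. g u * v u)"
  shows "continuous_on {a..c} v"
proof -
  have "continuous_on {a..c} (\<lambda>t. v a - integral {a..t} (\<lambda>u. g u * v u))"
    using gv by (intro continuous_intros indefinite_integral_continuous_1)
      (rule absolutely_integrable_on_def[THEN iffD1, THEN conjunct1])
  moreover have "v a - integral {a..t} (\<lambda>u. g u * v u) = v t" if "t \<in> {a..c}" for t
    using eq[of a t] that by simp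
  ultimately show ?thesis
    using continuous_on_cong[OF refl, of "{a..c}" "\<lambda>t. v a - integral {a..t} (\<lambda>u. g u * v u)" v]
    by simp
qed

text \<open>A positive value of \<open>g\<close> pulls \<open>v\<close> back to 0, so only the
  negative part of \<open>g\<close> can drive \<open>v\<close> away from it. If \<open>v c\<close>
  were positive, a Gronwall argument with the negative part alone, started at the last zero of
  \<open>v\<close>, would give a contradiction.\<close>

lemma linear_flow_nonpos:
  fixes g v :: "real \<Rightarrow> real"
  assumes ac: "a \<le> c"
    and gv: "(\<lambda>u. g u * v u) absolutely_integrable_on {a..c}"
    and gm: "(\<lambda>u. max 0 (- g u)) absolutely_integrable_on {a..c}"
    and eq: "\<And>s t. a \<le> s \<Longrightarrow> s \<le> t \<Longrightarrow> t \<le> c \<Longrightarrow> v t - v s = - integral {s..t} (\<lambda>u. g u * v u)"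
    and va: "v a = 0"
  shows "v c \<le> 0"
proof (rule ccontr)
  assume "\<not> v c \<le> 0"
  then have vc: "v c > 0" by simp
  have cont: "continuous_on {a..c} v"
    using gv eq by (rule linear_flow_continuous)
  define S where "S = {u\<in>{a..c}. v u = 0}"
  have "closed S"
    unfolding S_def using continuous_closed_preimage_constant[OF cont] by auto
  moreover have "a \<in> S" using ac va by (simp add: S_def)
  moreover have bdd: "bdd_above S" by (auto simp: S_def bdd_above_def)
  ultimately have "Sup S \<in> S" by (intro closed_contains_Sup) auto
  define r where "r = Sup S"
  have r: "a \<le> r" "r \<le> c" "v r = 0" using \<open>Sup S \<in> S\<close> by (auto simp: r_def S_def)
  have rc: "r < c" using r vc by (cases "r = c") auto
  have pos: "v u \<ge> 0" if "r \<le> u" "u \<le> c" for u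
  proof (rule ccontr)
    assume "\<not> v u \<ge> 0"
    moreover have "continuous_on {u..c} v"
      using cont by (rule continuous_on_subset) (use r that in auto)
    ultimately obtain p where p: "u \<le> p" "p \<le> c" "v p = 0"
      using IVT'[of v u 0 c] vc \<open>u \<le> c\<close> by (metis less_eq_real_def linorder_not_le)
    then have "p \<le> r"
      unfolding r_def using r that by (intro cSup_upper bdd) (auto simp: S_def)
    then have "u = r" using p that by simp
    then show False using \<open>\<not> v u \<ge> 0\<close> r by simp
  qed
  have gm': "(\<lambda>u. max 0 (- g u)) integrable_on {s..t}" if "a \<le> s" "t \<le> c" for s t
    using gm integrable_on_subinterval[of _ "{a..c}" s t] that
    by (auto simp: absolutely_integrable_on_def)
  define N where "N t = integral {r..t} (\<lambda>u. max 0 (- g u))" for t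
  have "continuous_on {r..c} N"
    unfolding N_def using gm' r by (intro indefinite_integral_continuous_1) auto
  moreover have "N r = 0" by (simp add: N_def)
  ultimately obtain d where d: "d > 0" "\<And>t. t \<in> {r..c} \<Longrightarrow> dist t r < d \<Longrightarrow> dist (N t) 0 < 1/2"
    unfolding continuous_on_iff using rc by (metis atLeastAtMost_iff half_gt_zero_iff less_eq_real_def zero_less_one)
  \<comment> \<open>On \<open>{r..t}\<close> the negative part of \<open>g\<close> has mass below
    1/2. At a maximum point \<open>p\<close> of \<open>v\<close> on this interval the integral
    equation yields \<open>v p \<le> N t * v p\<close>, which is impossible for
    \<open>v p > 0\<close>.\<close>
  define t where "t = min c (r + d/2)"
  have t: "r < t" "t \<le> c" "dist t r < d" using d(1) rc by (auto simp: t_def dist_real_def)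
  have Nt: "N t < 1/2" using d(2)[of t] t by (auto simp: dist_real_def)
  have "continuous_on {r..t} v" using cont by (rule continuous_on_subset) (use r t in auto)
  then obtain p where p: "p \<in> {r..t}" "\<And>u. u \<in> {r..t} \<Longrightarrow> v u \<le> v p"
    using continuous_attains_sup[of "{r..t}" v] t by auto
  have ivl: "(\<lambda>u. g u * v u) integrable_on {r..p}"
    using gv integrable_on_subinterval[of _ "{a..c}" r p] r t p
    by (auto simp: absolutely_integrable_on_def)
  have "v p = integral {r..p} (\<lambda>u. - (g u * v u))"
    using eq[of r p] r t p by (simp)
  also have "\<dots> \<le> integral {r..p} (\<lambda>u. max 0 (- g u) * v p)"
  proof (rule integral_le)
    fix u assume u: "u \<in> {r..p}"
    have "- (g u * v u) \<le> max 0 (- g u) * v u"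
      using pos[of u] u p t by (auto simp: max_def mult_nonneg_nonneg mult_le_0_iff)
    also have "\<dots> \<le> max 0 (- g u) * v p"
      using p u by (intro mult_left_mono) auto
    finally show "- (g u * v u) \<le> max 0 (- g u) * v p" .
  qed (use ivl gm'[of r p] r t p in \<open>auto intro!: integrable_neg integrable_on_mult_left\<close>)
  also have "\<dots> = N p * v p"
    by (simp add: N_def)
  also have "\<dots> \<le> N t * v p"
  proof (intro mult_right_mono)
    show "N p \<le> N t" unfolding N_def
      using gm' r t p by (intro integral_subset_le) auto
    show "v p \<ge> 0" using pos[of p] p t by auto
  qed
  finally have 1: "v p \<le> N t * v p" .
  have "v p > 0"
  proof -
    have "v t \<le> v p" using p t by auto
    moreover have "v t > 0"
    proof (rule ccontr)
      assume "\<not> 0 < v t"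
      then have "t \<in> S" using pos[of t] t r by (auto simp: S_def)
      then show False using cSup_upper[OF _ bdd, of t] t by (simp add: r_def)
    qed
    ultimately show ?thesis by simp
  qed
  then have "N t * v p < 1 * v p" using Nt by (intro mult_strict_right_mono) auto
  then show False using 1 by simp
qed

lemma linear_flow_zero:
  fixes g v :: "real \<Rightarrow> real"
  assumes ac: "a \<le> c"
    and gv: "(\<lambda>u. g u * v u) absolutely_integrable_on {a..c}"
    and gm: "(\<lambda>u. max 0 (- g u)) absolutely_integrable_on {a..c}"
    and eq: "\<And>s t. a \<le> s \<Longrightarrow> s \<le> t \<Longrightarrow> t \<le> c \<Longrightarrow> v t - v s = - integral {s..t} (\<lambda>u. g u * v u)"
    and va: "v a = 0"
  shows "v c = 0"
proof -
  have "v c \<le> 0" using assms by (rule linear_flow_nonpos)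
  moreover have "- v c \<le> 0"
  proof (rule linear_flow_nonpos[of a c g "\<lambda>u. - v u"])
    show "(\<lambda>u. g u * - v u) absolutely_integrable_on {a..c}"
      using gv by (simp add: absolutely_integrable_on_def integrable_neg_iff)
    show "- v t - - v s = - integral {s..t} (\<lambda>u. g u * - v u)"
      if "a \<le> s" "s \<le> t" "t \<le> c" for s t
      using eq[OF that] by simp
  qed (use ac gm va in auto)
  ultimately show ?thesis by simp
qed

text \<open>Since \<open>v\<close> is only absolutely continuous, no pointwise derivative is used: the increments of
  \<open>d = v * exp (\<integral> g)\<close> are quadratically small in those of \<open>A = \<integral> \<bar>g\<bar>\<close>, so \<open>d\<close> is constant.\<close>

lemma linear_flow_exp:
  fixes g v :: "real \<Rightarrow> real"
  assumes ac: "a \<le> c"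
    and gv: "(\<lambda>u. g u * v u) absolutely_integrable_on {a..c}"
    and g: "g absolutely_integrable_on {a..c}"
    and eq: "\<And>s t. a \<le> s \<Longrightarrow> s \<le> t \<Longrightarrow> t \<le> c \<Longrightarrow> v t - v s = - integral {s..t} (\<lambda>u. g u * v u)"
  shows "v c = exp (- integral {a..c} g) * v a"
proof -
  have cont: "continuous_on {a..c} v"
    using gv eq by (rule linear_flow_continuous)
  define G where "G t = integral {a..t} g" for t
  define A where "A t = integral {a..t} (\<lambda>u. \<bar>g u\<bar>)" for t
  define d where "d t = v t * exp (G t)" for t
  have gI: "g integrable_on {s..t}" "(\<lambda>u. \<bar>g u\<bar>) integrable_on {s..t}"
    "(\<lambda>u. g u * v u) integrable_on {s..t}" if "a \<le> s" "t \<le> c" for s t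
    using g gv integrable_on_subinterval[of _ "{a..c}" s t] that
    by (auto simp: absolutely_integrable_on_def)
  have contG: "continuous_on {a..c} G" and contA: "continuous_on {a..c} A"
    unfolding G_def A_def using gI[of a c] by (auto intro!: indefinite_integral_continuous_1)
  have G_diff: "G t - G s = integral {s..t} g" and A_diff: "A t - A s = integral {s..t} (\<lambda>u. \<bar>g u\<bar>)"
    if "a \<le> s" "s \<le> t" "t \<le> c" for s t
    using Henstock_Kurzweil_Integration.integral_combine[where a=a and c=s and b=t and f=g]
      Henstock_Kurzweil_Integration.integral_combine[where a=a and c=s and b=t and f="\<lambda>u. \<bar>g u\<bar>"] gI[of a t] that
    by (auto simp: G_def A_def)
  obtain M where M: "M > 0" "\<And>t. t \<in> {a..c} \<Longrightarrow> \<bar>v t\<bar> \<le> M"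
    using compact_imp_bounded[OF compact_continuous_image[OF cont compact_Icc]]
    by (auto simp: bounded_pos)
  obtain K where K: "K > 0" "\<And>t. t \<in> {a..c} \<Longrightarrow> \<bar>exp (G t)\<bar> \<le> K"
    using compact_imp_bounded[OF compact_continuous_image[OF continuous_on_exp[OF contG] compact_Icc]]
    by (auto simp: bounded_pos)
  have step: "\<bar>d q - d p\<bar> \<le> K * (4 * M * (A q - A p)\<^sup>2)"
    if pq: "a \<le> p" "p \<le> q" "q \<le> c" and small: "A q - A p \<le> 1" for p q
  proof -
    define I where "I = G q - G p"
    define D where "D = A q - A p"
    \<comment> \<open>\<open>R\<close> is the error of freezing \<open>v\<close> at the left end
      \<open>p\<close> in the integral equation; by \<open>osc\<close> it is quadratic in
      \<open>D\<close>.\<close>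
    define R where "R = integral {p..q} (\<lambda>u. g u * (v u - v p))"
    have I: "I = integral {p..q} g" and D: "D = integral {p..q} (\<lambda>u. \<bar>g u\<bar>)"
      using G_diff[OF pq] A_diff[OF pq] by (auto simp: I_def D_def)
    have ID: "\<bar>I\<bar> \<le> D"
      unfolding I D using integral_norm_bound_integral[of g "{p..q}" "\<lambda>u. \<bar>g u\<bar>"] gI[of p q] pq by auto
    have D1: "0 \<le> D" "D \<le> 1" using small ID by (auto simp: D_def)
    have osc: "\<bar>v y - v p\<bar> \<le> M * D" if y: "y \<in> {p..q}" for y
    proof -
      have MI: "(\<lambda>u. M * \<bar>g u\<bar>) integrable_on {p..y}"
        using gI(2)[of p y] pq y by (intro integrable_on_mult_right) auto
      have Mv: "\<bar>g u * v u\<bar> \<le> M * \<bar>g u\<bar>" if "u \<in> {p..y}" for u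
        using M(2)[of u] that pq y by (simp add: abs_mult mult.commute[of M] mult_left_mono)
      have "\<bar>v y - v p\<bar> = \<bar>integral {p..y} (\<lambda>u. g u * v u)\<bar>"
        using eq[of p y] pq y by auto
      also have "\<dots> \<le> integral {p..y} (\<lambda>u. M * \<bar>g u\<bar>)"
        using integral_norm_bound_integral[of "\<lambda>u. g u * v u" "{p..y}" "\<lambda>u. M * \<bar>g u\<bar>"] gI[of p y] pq y Mv MI
        by (auto simp del: integral_mult_right)
      also have "\<dots> = M * integral {p..y} (\<lambda>u. \<bar>g u\<bar>)" by simp
      also have "\<dots> \<le> M * D"
        unfolding D using gI[of p y] gI[of p q] pq y M
        by (intro mult_left_mono integral_subset_le) auto
      finally show ?thesis .
    qed
    have RI: "(\<lambda>u. g u * (v u - v p)) integrable_on {p..q}"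
      using integrable_diff[OF gI(3)[of p q] integrable_on_mult_left[OF gI(1)[of p q], of "v p"]] pq
      by (simp add: algebra_simps)
    have R: "\<bar>R\<bar> \<le> M * D\<^sup>2"
    proof -
      have "(\<lambda>u. (M * D) * \<bar>g u\<bar>) integrable_on {p..q}"
        using gI(2)[of p q] pq by (intro integrable_on_mult_right) auto
      moreover have "\<bar>g u * (v u - v p)\<bar> \<le> (M * D) * \<bar>g u\<bar>" if "u \<in> {p..q}" for u
        using osc[OF that] by (simp add: abs_mult mult.commute[of "M * D"] mult_left_mono)
      ultimately have "\<bar>R\<bar> \<le> integral {p..q} (\<lambda>u. (M * D) * \<bar>g u\<bar>)"
        unfolding R_def
        using integral_norm_bound_integral[of "\<lambda>u. g u * (v u - v p)" "{p..q}" "\<lambda>u. (M * D) * \<bar>g u\<bar>"]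
RI
        by (auto simp del: integral_mult_right)
      also have "\<dots> = M * D\<^sup>2" by (simp add: D power2_eq_square)
      finally show ?thesis .
    qed
    have vq: "v q = v p - v p * I - R"
    proof -
      have "integral {p..q} (\<lambda>u. g u * v u) = integral {p..q} (\<lambda>u. g u * (v u - v p) + g u * v p)"
        by (simp add: algebra_simps)
      also have "\<dots> = R + I * v p"
        unfolding R_def I using RI gI[of p q] pq
        by (subst integral_add) (auto intro!: integrable_on_mult_left)
      finally show ?thesis using eq[OF pq] by (simp add: mult.commute)
    qed
    \<comment> \<open>The first order terms cancel. What is left is the Taylor remainder of
      \<open>exp\<close>, the square of the first order increment and the freezing error, each of
      order \<open>D\<^sup>2\<close>.\<close>
    have "v q * exp I - v p = v q * (exp I - 1 - I) - v p * I\<^sup>2 - R * (1 + I)"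
      unfolding vq by (simp add: algebra_simps power2_eq_square)
    also have "\<bar>\<dots>\<bar> \<le> M * D\<^sup>2 + M * D\<^sup>2 + (M * D\<^sup>2) * 2"
    proof -
      have I2: "I\<^sup>2 \<le> D\<^sup>2" using ID by (intro abs_le_square_iff[THEN iffD1]) auto
      have "\<bar>v q * (exp I - 1 - I)\<bar> \<le> M * D\<^sup>2"
        unfolding abs_mult using M(2)[of q] pq exp_taylor1_bound[of I] I2 ID D1 M(1)
        by (intro mult_mono) auto
      moreover have "\<bar>v p * I\<^sup>2\<bar> \<le> M * D\<^sup>2"
        unfolding abs_mult using M(2)[of p] pq I2 M(1) by (intro mult_mono) auto
      moreover have "\<bar>R * (1 + I)\<bar> \<le> (M * D\<^sup>2) * 2"
        unfolding abs_mult using R ID D1 M(1) by (intro mult_mono) auto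
      ultimately show ?thesis by linarith
    qed
    finally have main: "\<bar>v q * exp I - v p\<bar> \<le> 4 * M * D\<^sup>2" by simp
    have "d q - d p = exp (G p) * (v q * exp I - v p)"
      by (simp add: d_def I_def algebra_simps flip: exp_add)
    then have "\<bar>d q - d p\<bar> = \<bar>exp (G p)\<bar> * \<bar>v q * exp I - v p\<bar>"
      by (simp add: abs_mult)
    also have "\<dots> \<le> K * (4 * M * D\<^sup>2)"
      using K(2)[of p] K(1) pq main by (intro mult_mono) auto
    finally show ?thesis by (simp add: D_def)
  qed
  have "\<bar>d c - d a\<bar> \<le> e * (A c - A a)" if e: "e > 0" for e
  proof -
    \<comment> \<open>The estimate is additive over adjacent intervals, so by bisection it suffices
      on small intervals around each point. There continuity of \<open>A\<close> makes the quadratic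
      error of \<open>step\<close> at most \<open>e\<close> times the increment of
      \<open>A\<close>.\<close>
    define P where "P p q \<longleftrightarrow> (a \<le> p \<and> q \<le> c \<longrightarrow> \<bar>d q - d p\<bar> \<le> e * (A q - A p))" for p q
    have "P a c"
    proof (rule Bolzano[OF ac])
      fix p q r assume "P p q" "P q r" "p \<le> q" "q \<le> r"
      then show "P p r" by (auto simp: P_def algebra_simps)
    next
      fix x assume x: "a \<le> x" "x \<le> c"
      \<comment> \<open>The bound 1 is what \<open>step\<close> asks for; the other one makes
        \<open>4 * K * M * D\<close> at most \<open>e\<close>.\<close>
      define k where "k = min 1 (e / (4 * K * M))"
      have k: "k > 0" using e K M by (simp add: k_def)
      then obtain h where h: "h > 0" "\<And>y. y \<in> {a..c} \<Longrightarrow> dist y x < h \<Longrightarrow> dist (A y) (A x) < k / 2"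
        using contA x unfolding continuous_on_iff by (metis atLeastAtMost_iff half_gt_zero)
      show "\<exists>h>0. \<forall>p q. p \<le> x \<and> x \<le> q \<and> q - p < h \<longrightarrow> P p q"
        unfolding P_def
      proof (intro exI[of _ h] conjI allI impI)
        fix p q assume pq: "p \<le> x \<and> x \<le> q \<and> q - p < h" "a \<le> p \<and> q \<le> c"
        define D where "D = A q - A p"
        have "dist (A p) (A x) < k / 2" "dist (A q) (A x) < k / 2"
          using h(2)[of p] h(2)[of q] pq by (auto simp: dist_real_def)
        then have Dk: "D \<le> k" unfolding dist_real_def D_def by argo
        have D0: "0 \<le> D"
          unfolding D_def using A_diff[of p q] pq gI(2)[of p q] by (auto intro!: integral_nonneg)
        have "\<bar>d q - d p\<bar> \<le> K * (4 * M * D\<^sup>2)"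
          unfolding D_def using pq Dk by (intro step) (auto simp: k_def D_def)
        also have "\<dots> = (4 * K * M * D) * D" by (simp add: power2_eq_square)
        also have "\<dots> \<le> e * D"
        proof (rule mult_right_mono)
          have "D \<le> e / (4 * K * M)" using Dk by (simp add: k_def)
          then show "4 * K * M * D \<le> e" using K M by (simp add: field_simps)
        qed (rule D0)
        finally show "\<bar>d q - d p\<bar> \<le> e * (A q - A p)" by (simp add: D_def)
      qed (rule h)
    qed
    then show ?thesis by (simp add: P_def)
  qed
  then have bound: "\<bar>d c - d a\<bar> \<le> e * (A c - A a)" if "e > 0" for e using that by blast
  have "\<bar>d c - d a\<bar> \<le> 0"
  proof (rule field_le_epsilon)
    fix e :: real assume e: "e > 0"
    have "0 \<le> A c - A a"
      using A_diff[of a c] ac gI(2)[of a c] by (auto intro!: integral_nonneg)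
    then have "e / (A c - A a + 1) * (A c - A a) \<le> e"
      using e by (simp add: field_simps)
    then show "\<bar>d c - d a\<bar> \<le> 0 + e"
      using bound[of "e / (A c - A a + 1)"] e \<open>0 \<le> A c - A a\<close> by simp
  qed
  then have "d c = d a" by simp
  then show ?thesis
    by (simp add: d_def G_def exp_minus field_simps)
qed

text \<open>Once \<open>v\<close> vanishes it stays 0, so \<open>v c \<noteq> 0\<close> keeps the
  continuous function \<open>v\<close> away from 0 on the compact interval; dividing the integrable
  product \<open>g u * v u\<close> by \<open>v u\<close> recovers \<open>g\<close>.\<close>

lemma linear_flow_nonzero_imp_integrable:
  fixes g v :: "real \<Rightarrow> real"
  assumes ac: "a \<le> c"
    and gv: "(\<lambda>u. g u * v u) absolutely_integrable_on {a..c}"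
    and gm: "(\<lambda>u. max 0 (- g u)) absolutely_integrable_on {a..c}"
    and eq: "\<And>s t. a \<le> s \<Longrightarrow> s \<le> t \<Longrightarrow> t \<le> c \<Longrightarrow> v t - v s = - integral {s..t} (\<lambda>u. g u * v u)"
    and vc: "v c \<noteq> 0"
  shows "g absolutely_integrable_on {a..c}"
proof -
  have cont: "continuous_on {a..c} v"
    using gv eq by (rule linear_flow_continuous)
  have nz: "v u \<noteq> 0" if u: "u \<in> {a..c}" for u
  proof
    assume "v u = 0"
    then have "v c = 0"
    proof (intro linear_flow_zero[of u c g v])
      show "(\<lambda>u. g u * v u) absolutely_integrable_on {u..c}"
        "(\<lambda>u. max 0 (- g u)) absolutely_integrable_on {u..c}"
        using u by (auto intro: absolutely_integrable_on_subinterval[OF gv] absolutely_integrable_on_subinterval[OF gm])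
    qed (use eq u in auto)
    then show False using vc by simp
  qed
  have ci: "continuous_on {a..c} (\<lambda>u. inverse (v u))"
    using cont nz by (intro continuous_on_inverse) auto
  have "(\<lambda>u. inverse (v u) * (g u * v u)) absolutely_integrable_on {a..c}"
  proof (rule absolutely_integrable_bounded_measurable_product_real)
    show "(\<lambda>u. inverse (v u)) \<in> borel_measurable (lebesgue_on {a..c})"
      using ci by (intro continuous_imp_measurable_on_sets_lebesgue) auto
    show "bounded ((\<lambda>u. inverse (v u)) ` {a..c})"
      using compact_continuous_image[OF ci] compact_imp_bounded by blast
  qed (use gv in auto)
  moreover have "inverse (v u) * (g u * v u) = g u" if "u \<in> {a..c}" for u
    using nz[OF that] by simp
  ultimately show ?thesis
    by (metis (no_types, lifting) set_integrable_cong)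
qed

text \<open>The value 0 for a nonintegrable rate is the correct one: there the positive part of \<open>g\<close> has infinite
  integral and forces the solution to vanish.\<close>

definition decay :: "(real \<Rightarrow> real) \<Rightarrow> real \<Rightarrow> real \<Rightarrow> real" where
  "decay g s t = (if set_integrable lborel {s..t} g then exp (- (LBINT u:{s..t}. g u)) else 0)"

lemma set_integrable_lborel_iff_lebesgue:
  fixes g :: "real \<Rightarrow> 'b::euclidean_space"
  assumes "g \<in> borel_measurable borel" "S \<in> sets borel"
  shows "set_integrable lborel S g \<longleftrightarrow> g absolutely_integrable_on S"
  unfolding set_integrable_def using assms by (subst integrable_completion) auto

lemma linear_flow_decay:
  fixes g v :: "real \<Rightarrow> real"
  assumes ac: "a \<le> c" and gb: "g \<in> borel_measurable borel"
    and gv: "(\<lambda>u. g u * v u) absolutely_integrable_on {a..c}"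
    and gm: "(\<lambda>u. max 0 (- g u)) absolutely_integrable_on {a..c}"
    and eq: "\<And>s t. a \<le> s \<Longrightarrow> s \<le> t \<Longrightarrow> t \<le> c \<Longrightarrow> v t - v s = - integral {s..t} (\<lambda>u. g u * v u)"
  shows "v c = decay g a c * v a"
proof (cases "g absolutely_integrable_on {a..c}")
  case True
  then have si: "set_integrable lborel {a..c} g"
    using gb by (subst set_integrable_lborel_iff_lebesgue) auto
  show ?thesis
    using linear_flow_exp[OF ac gv True eq] set_borel_integral_eq_integral(2)[OF si] si
    by (simp add: decay_def)
next
  case False
  then have "\<not> set_integrable lborel {a..c} g"
    using gb by (subst set_integrable_lborel_iff_lebesgue) auto
  moreover have "v c = 0"
    using linear_flow_nonzero_imp_integrable[OF ac gv gm eq] False by blast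
  ultimately show ?thesis by (simp add: decay_def)
qed

section \<open>The flow between two jumps\<close>

text \<open>This is the displacement of one component per unit of initial gap.
  \<open>solves_flow\<close> controls only intervals that end before the next jump, so the integral
  up to \<open>t\<close> is an improper one; a fixed sequence of upper ends keeps the limit
  measurable in \<open>s\<close> and \<open>t\<close>.\<close>

definition transfer :: "(real \<Rightarrow> real) \<Rightarrow> (real \<Rightarrow> real) \<Rightarrow> real \<Rightarrow> real \<Rightarrow> real" where
  "transfer h g s t = lim (\<lambda>n. LBINT u:{s..t - (t - s) / real (Suc n)}. h u * decay g s u)"

text \<open>If the decay vanishes immediately after \<open>s\<close>, a right continuous solution has \<open>x s = z s\<close> and is
  constant, so the coefficient is arbitrary; the value 1 is the one required for the rate \<open>2 / t\<close> at \<open>s = 0\<close>.\<close>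

definition mix_coeff :: "(real \<Rightarrow> real) \<Rightarrow> (real \<Rightarrow> real) \<Rightarrow> real \<Rightarrow> real \<Rightarrow> real" where
  "mix_coeff \<eta> \<eta>' s t =
    (if \<forall>n. decay (\<lambda>u. \<eta> u + \<eta>' u) s (s + (t - s) / real (n + 2)) = 0 then 1
     else transfer \<eta> (\<lambda>u. \<eta> u + \<eta>' u) s t)"

text \<open>With initial gap \<open>w\<close>, the component \<open>z\<close> moves by
  \<open>- transfer\<close> times \<open>w\<close>, while \<open>y - z\<close> is
  \<open>- (1 - mix_coeff)\<close> times \<open>w\<close>; the quotient converts one into the other.
  When \<open>mix_coeff\<close> is 1, division by zero gives the value 0.\<close>

definition mix_coeff' :: "(real \<Rightarrow> real) \<Rightarrow> (real \<Rightarrow> real) \<Rightarrow> real \<Rightarrow> real \<Rightarrow> real" where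
  "mix_coeff' \<eta> \<eta>' s t = transfer \<eta>' (\<lambda>u. \<eta> u + \<eta>' u) s t / (1 - mix_coeff \<eta> \<eta>' s t)"

lemma borel_measurable_decay [measurable (raw)]:
  assumes g: "g \<in> borel_measurable borel"
    and [measurable]: "p \<in> borel_measurable M" "q \<in> borel_measurable M"
  shows "(\<lambda>x. decay g (p x) (q x)) \<in> borel_measurable M"
proof -
  note [measurable] = g
  have "(\<lambda>(x, u). indicator {p x..q x} u *\<^sub>R g u) \<in> borel_measurable (M \<Otimes>\<^sub>M lborel)"
    unfolding indicator_def atLeastAtMost_iff by measurable
  then show ?thesis
    unfolding decay_def set_integrable_def set_lebesgue_integral_def by measurable
qed

lemma borel_measurable_transfer [measurable (raw)]:
  assumes h: "h \<in> borel_measurable borel" and g: "g \<in> borel_measurable borel"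
    and [measurable]: "p \<in> borel_measurable M" "q \<in> borel_measurable M"
  shows "(\<lambda>x. transfer h g (p x) (q x)) \<in> borel_measurable M"
proof -
  note [measurable] = h g
  have "(\<lambda>(x, u). indicator {p x..q x - (q x - p x) / real (Suc n)} u *\<^sub>R (h u * decay g (p x) u))
      \<in> borel_measurable (M \<Otimes>\<^sub>M lborel)" for n
    unfolding indicator_def atLeastAtMost_iff by measurable
  then show ?thesis
    unfolding transfer_def set_lebesgue_integral_def by measurable
qed

lemma borel_measurable_mix_coeff:
  assumes [measurable]: "\<eta> \<in> borel_measurable borel" "\<eta>' \<in> borel_measurable borel"
    "p \<in> borel_measurable M" "q \<in> borel_measurable M"
  shows "(\<lambda>x. mix_coeff \<eta> \<eta>' (p x) (q x)) \<in> borel_measurable M"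
    and "(\<lambda>x. mix_coeff' \<eta> \<eta>' (p x) (q x)) \<in> borel_measurable M"
  unfolding mix_coeff_def mix_coeff'_def by measurable

lemma solves_flow_inner:
  assumes "solves_flow \<eta> p q a b" "a \<le> s" "s \<le> t" "t < b"
  shows "(\<lambda>u. \<eta> u * ((q u - p u) \<bullet> e)) absolutely_integrable_on {s..t}"
    and "p t \<bullet> e - p s \<bullet> e = integral {s..t} (\<lambda>u. \<eta> u * ((q u - p u) \<bullet> e))"
proof -
  let ?h = "\<lambda>u. \<eta> u *\<^sub>R (q u - p u)"
  have h: "?h absolutely_integrable_on {s..t}" "p t - p s = integral {s..t} ?h"
    using assms by (auto simp: solves_flow_def)
  have 1: "(\<lambda>u. ?h u \<bullet> e) absolutely_integrable_on {s..t}"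
    using absolutely_integrable_linear[OF h(1) bounded_linear_inner_left[of e]] by (simp add: comp_def)
  then show "(\<lambda>u. \<eta> u * ((q u - p u) \<bullet> e)) absolutely_integrable_on {s..t}" by simp
  have "(p t - p s) \<bullet> e = integral {s..t} (\<lambda>u. ?h u \<bullet> e)"
    unfolding h(2) using integral_linear[OF _ bounded_linear_inner_left[of e], of ?h "{s..t}"] h(1)
    by (simp add: comp_def absolutely_integrable_on_def)
  then show "p t \<bullet> e - p s \<bullet> e = integral {s..t} (\<lambda>u. \<eta> u * ((q u - p u) \<bullet> e))"
    by (simp add: inner_diff_left)
qed

lemma mixing_rate_integrable:
  assumes "mixing_rate \<eta>" "0 \<le> a"
  shows "(\<lambda>u. max 0 (- \<eta> u)) absolutely_integrable_on {a..c}"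
proof (cases "a \<le> c")
  case True
  have [measurable]: "\<eta> \<in> borel_measurable borel" using assms by (simp add: mixing_rate_def)
  have "(\<lambda>u. max 0 (- \<eta> u)) absolutely_integrable_on {0..c}"
    using assms True unfolding mixing_rate_def
    by (subst set_integrable_lborel_iff_lebesgue[symmetric]) auto
  then show ?thesis
    by (rule absolutely_integrable_on_subinterval) (use assms in auto)
qed simp

text \<open>Each coordinate of the gap solves the scalar equation whose rate is the sum of the two
  rates. The negative part of the sum is dominated by the sum of the negative parts, which is where
  both \<open>mixing_rate\<close> hypotheses enter.\<close>

lemma flow_gap:
  fixes x z :: "real \<Rightarrow> 'a::euclidean_space"
  assumes x: "solves_flow \<eta> x z a b" and z: "solves_flow \<eta>' z x a b"
    and rates: "mixing_rate \<eta>" "mixing_rate \<eta>'" and a: "0 \<le> a" "a \<le> t" "t < b"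
  shows "z t - x t = decay (\<lambda>u. \<eta> u + \<eta>' u) a t *\<^sub>R (z a - x a)"
proof (rule euclidean_eqI)
  fix e :: 'a
  define g where "g u = \<eta> u + \<eta>' u" for u
  define v where "v u = (z u - x u) \<bullet> e" for u
  have [measurable]: "\<eta> \<in> borel_measurable borel" "\<eta>' \<in> borel_measurable borel"
    using rates by (auto simp: mixing_rate_def)
  have g: "g \<in> borel_measurable borel" unfolding g_def by measurable
  have gm: "(\<lambda>u. max 0 (- g u)) absolutely_integrable_on {a..t}"
  proof (rule measurable_bounded_by_integrable_imp_absolutely_integrable)
    show "(\<lambda>u. max 0 (- g u)) \<in> borel_measurable (lebesgue_on {a..t})"
      using g by (intro measurable_restrict_space1 measurable_completion) auto
    show "(\<lambda>u. max 0 (- \<eta> u) + max 0 (- \<eta>' u)) integrable_on {a..t}"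
      using mixing_rate_integrable[OF rates(1) a(1)] mixing_rate_integrable[OF rates(2) a(1)]
      by (intro integrable_add) (auto simp: absolutely_integrable_on_def)
  qed (auto simp: g_def)
  have split: "(\<lambda>u. g u * v u) = (\<lambda>u. \<eta> u * ((z u - x u) \<bullet> e) - \<eta>' u * ((x u - z u) \<bullet> e))"
    by (auto simp: g_def v_def algebra_simps inner_diff_left)
  have 1: "(\<lambda>u. g u * v u) absolutely_integrable_on {a..t}"
    unfolding split using solves_flow_inner(1)[OF x, of a t e] solves_flow_inner(1)[OF z, of a t e] a
    by (intro set_integral_diff(1)) auto
  have 2: "v t' - v s = - integral {s..t'} (\<lambda>u. g u * v u)" if "a \<le> s" "s \<le> t'" "t' \<le> t" for s t'
  proof -
    have "t' < b" using that a by simp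
    note sx = solves_flow_inner[OF x that(1,2) this, of e] and sz = solves_flow_inner[OF z that(1,2) this, of e]
    show ?thesis
      unfolding split using sx sz
      by (subst integral_diff) (auto simp: absolutely_integrable_on_def v_def inner_diff_left)
  qed
  have "v t = decay g a t * v a"
    using a(2) g 1 gm 2 by (rule linear_flow_decay)
  then show "(z t - x t) \<bullet> e = (decay (\<lambda>u. \<eta> u + \<eta>' u) a t *\<^sub>R (z a - x a)) \<bullet> e"
    by (simp add: v_def g_def[abs_def])
qed

text \<open>Convergence of the improper integral is read off the left limit of \<open>p\<close>: as
  \<open>w\<close> is nonzero, the truncated integral is the coefficient of \<open>w\<close> in the
  displacement of \<open>p\<close>, and it is recovered by projecting onto \<open>w\<close>.\<close>

lemma flow_transfer:
  fixes p q :: "real \<Rightarrow> 'a::euclidean_space"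
  assumes p: "solves_flow h p q a b"
    and gap: "\<And>t. a \<le> t \<Longrightarrow> t < b \<Longrightarrow> q t - p t = decay g a t *\<^sub>R w"
    and meas: "h \<in> borel_measurable borel" "g \<in> borel_measurable borel"
    and lim: "(p \<longlongrightarrow> l) (at_left b)" and ab: "a < b" and w: "w \<noteq> 0"
  shows "l = p a + transfer h g a b *\<^sub>R w"
    and "(\<lambda>n. LBINT u:{a..b - (b - a) / real (Suc n)}. h u * decay g a u) \<longlonglongrightarrow> transfer h g a b"
proof -
  define b' where "b' n = b - (b - a) / real (Suc n)" for n
  define J where "J n = (LBINT u:{a..b' n}. h u * decay g a u)" for n
  note [measurable] = meas
  have b': "a \<le> b' n" "b' n < b" for n
  proof -
    have "(b - a) / real (Suc n) \<le> b - a" "0 < (b - a) / real (Suc n)"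
      using ab divide_left_mono[of 1 "real (Suc n)" "b - a"] by simp_all
    then show "a \<le> b' n" "b' n < b" unfolding b'_def by linarith+
  qed
  have inner: "p (b' n) \<bullet> e - p a \<bullet> e = J n * (w \<bullet> e)" for n e
  proof (cases "w \<bullet> e = 0")
    case True
    have "integral {a..b' n} (\<lambda>u. h u * ((q u - p u) \<bullet> e)) = integral {a..b' n} (\<lambda>u. 0)"
      by (intro integral_cong) (use gap b'[of n] True in auto)
    then show ?thesis
      using solves_flow_inner(2)[OF p order_refl b', of n e] True by simp
  next
    \<comment> \<open>The flow equation gives integrability only after multiplication by
      \<open>w \<bullet> e\<close>; a nonzero factor can be divided out.\<close>
    case False
    have eq: "h u * ((q u - p u) \<bullet> e) = (w \<bullet> e) *\<^sub>R (h u * decay g a u)" if "u \<in> {a..b' n}" for u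
      using gap[of u] that b'[of n] by simp
    have "(\<lambda>u. (w \<bullet> e) *\<^sub>R (h u * decay g a u)) absolutely_integrable_on {a..b' n}"
      using solves_flow_inner(1)[OF p order_refl b', of n e]
      by (rule set_integrable_cong[THEN iffD1, rotated -1]) (use eq in auto)
    then have "(\<lambda>u. h u * decay g a u) absolutely_integrable_on {a..b' n}"
      using False by (simp add: absolutely_integrable_on_scaleR_iff)
    then have "set_integrable lborel {a..b' n} (\<lambda>u. h u * decay g a u)"
      by (subst set_integrable_lborel_iff_lebesgue) auto
    then have J: "J n = integral {a..b' n} (\<lambda>u. h u * decay g a u)"
      unfolding J_def by (rule set_borel_integral_eq_integral)
    have "integral {a..b' n} (\<lambda>u. h u * ((q u - p u) \<bullet> e))
        = integral {a..b' n} (\<lambda>u. (w \<bullet> e) *\<^sub>R (h u * decay g a u))"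
      using eq by (intro integral_cong) auto
    then show ?thesis
      using solves_flow_inner(2)[OF p order_refl b', of n e] by (simp add: J)
  qed
  have step: "p (b' n) = p a + J n *\<^sub>R w" for n
    by (rule euclidean_eqI) (use inner[of n] in \<open>auto simp: inner_add_left algebra_simps\<close>)
  have "b' \<longlonglongrightarrow> b - 0"
    unfolding b'_def divide_inverse
    by (intro tendsto_diff tendsto_const tendsto_mult_right_zero LIMSEQ_inverse_real_of_nat)
  then have "filterlim b' (at_left b) sequentially"
    using b' by (auto simp: filterlim_at intro!: always_eventually)
  then have pl: "(\<lambda>n. p (b' n)) \<longlonglongrightarrow> l"
    by (rule filterlim_compose[OF lim])
  have Jeq: "J n = (p (b' n) - p a) \<bullet> w / (w \<bullet> w)" for n
    using w by (simp add: step)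
  have "J \<longlonglongrightarrow> (l - p a) \<bullet> w / (w \<bullet> w)"
    unfolding Jeq[abs_def] using w by (intro tendsto_intros pl) auto
  moreover have "transfer h g a b = lim J"
    by (simp add: transfer_def J_def[abs_def] b'_def)
  ultimately have JT: "J \<longlonglongrightarrow> transfer h g a b"
    by (simp add: limI)
  then show "(\<lambda>n. LBINT u:{a..b - (b - a) / real (Suc n)}. h u * decay g a u) \<longlonglongrightarrow> transfer h g a b"
    by (simp add: J_def[abs_def] b'_def)
  have "(\<lambda>n. p (b' n)) \<longlonglongrightarrow> p a + transfer h g a b *\<^sub>R w"
    unfolding step by (intro tendsto_intros JT)
  with pl show "l = p a + transfer h g a b *\<^sub>R w"
    by (rule LIMSEQ_unique)
qed

lemma decay_nonneg: "0 \<le> decay g s t"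
  by (simp add: decay_def)

lemma flow_constant:
  fixes p q :: "real \<Rightarrow> 'a::euclidean_space"
  assumes p: "solves_flow h p q a b"
    and gap: "\<And>t. a \<le> t \<Longrightarrow> t < b \<Longrightarrow> q t = p t"
    and lim: "(p \<longlongrightarrow> l) (at_left b)" and ab: "a < b"
  shows "l = p a"
proof -
  have const: "p t = p a" if "a \<le> t" "t < b" for t
  proof -
    have "integral {a..t} (\<lambda>u. h u *\<^sub>R (q u - p u)) = integral {a..t} (\<lambda>u. 0)"
      by (intro integral_cong) (use gap that in auto)
    moreover have "p t - p a = integral {a..t} (\<lambda>u. h u *\<^sub>R (q u - p u))"
      using p that unfolding solves_flow_def by blast
    ultimately show ?thesis by simp
  qed
  have "\<forall>\<^sub>F t in at_left b. p t = p a"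
    using eventually_at_left_real[OF ab] by eventually_elim (rule const; simp)
  then have "(p \<longlongrightarrow> p a) (at_left b)" by (rule tendsto_eventually)
  then show ?thesis using tendsto_unique[OF _ lim] by simp
qed

text \<open>The side condition of the second claim concerns the case where \<open>mix_coeff\<close>
  is 1. Then \<open>y = z a\<close>, so no multiple of \<open>y - z a\<close> can represent a motion
  of \<open>z\<close>; a nonnegative \<open>\<eta>'\<close> excludes such a motion.\<close>

lemma flow_between_jumps:
  fixes x z :: "real \<Rightarrow> 'a::euclidean_space"
  assumes x: "solves_flow \<eta> x z a b" and z: "solves_flow \<eta>' z x a b"
    and rates: "mixing_rate \<eta>" "mixing_rate \<eta>'" and ab: "0 \<le> a" "a < b"
    and rc: "continuous (at_right a) x" "continuous (at_right a) z"
    and lim: "(x \<longlongrightarrow> y) (at_left b)" "(z \<longlongrightarrow> y') (at_left b)"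
  shows "y = x a + mix_coeff \<eta> \<eta>' a b *\<^sub>R (z a - x a)"
    and "(\<forall>t>0. \<eta>' t \<ge> 0) \<or> mix_coeff \<eta> \<eta>' a b \<noteq> 1 \<Longrightarrow>
      y' = z a + mix_coeff' \<eta> \<eta>' a b *\<^sub>R (y - z a)"
proof -
  define g where "g u = \<eta> u + \<eta>' u" for u
  define w where "w = z a - x a"
  define \<rho> where "\<rho> = transfer \<eta>' g a b"
  have meas [measurable]: "\<eta> \<in> borel_measurable borel" "\<eta>' \<in> borel_measurable borel"
    using rates by (auto simp: mixing_rate_def)
  have gm: "g \<in> borel_measurable borel" unfolding g_def by measurable
  have gap: "z t - x t = decay g a t *\<^sub>R w" if "a \<le> t" "t < b" for t
    using flow_gap[OF x z rates ab(1) that] by (simp add: w_def g_def[abs_def])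
  have gap': "x t - z t = decay g a t *\<^sub>R (- w)" if "a \<le> t" "t < b" for t
    using gap[OF that] by (simp add: algebra_simps)
  have *: "y = x a + mix_coeff \<eta> \<eta>' a b *\<^sub>R w \<and> ((\<forall>t>0. \<eta>' t \<ge> 0) \<or> mix_coeff \<eta> \<eta>' a b \<noteq> 1 \<longrightarrow>
      y' = z a + mix_coeff' \<eta> \<eta>' a b *\<^sub>R (y - z a))"
  proof (cases "w = 0")
    case True
    then have "z t = x t" if "a \<le> t" "t < b" for t using gap[OF that] by simp
    then have "y = x a" "y' = z a"
      using flow_constant[OF x _ lim(1) ab(2)] flow_constant[OF z _ lim(2) ab(2)] by auto
    with True show ?thesis by (simp add: w_def)
  next
    case False
    have fx: "y = x a + transfer \<eta> g a b *\<^sub>R w"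
      using x gap meas(1) gm lim(1) ab(2) False by (rule flow_transfer(1))
    have fz: "y' = z a + \<rho> *\<^sub>R (- w)"
      "(\<lambda>n. LBINT u:{a..b - (b - a) / real (Suc n)}. \<eta>' u * decay g a u) \<longlonglongrightarrow> \<rho>"
      using flow_transfer[OF z gap' meas(2) gm lim(2) ab(2)] False unfolding \<rho>_def by auto
    \<comment> \<open>If the decay vanished at all these times, which decrease to \<open>a\<close>,
      the gap would be 0 there and right continuity would give \<open>w = 0\<close>. So the default
      branch of \<open>mix_coeff\<close> is not taken for a nonzero gap.\<close>
    have nd: "\<not> (\<forall>n. decay g a (a + (b - a) / real (n + 2)) = 0)"
    proof
      assume d: "\<forall>n. decay g a (a + (b - a) / real (n + 2)) = 0"
      define c where "c n = a + (b - a) / real (n + 2)" for n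
      have c: "a < c n" "c n < b" for n
      proof -
        have "(b - a) / real (n + 2) < b - a" "0 < (b - a) / real (n + 2)"
          using ab divide_strict_left_mono[of 1 "real (n + 2)" "b - a"] by simp_all
        then show "a < c n" "c n < b" unfolding c_def by linarith+
      qed
      have "(\<lambda>n. a + (b - a) * (1 / real (n + 2))) \<longlonglongrightarrow> a + (b - a) * 0"
        using LIMSEQ_ignore_initial_segment[OF lim_const_over_n[of 1], of 2]
        by (intro tendsto_intros) simp
      then have "filterlim c (at_right a) sequentially"
        using c by (auto simp: filterlim_at c_def[abs_def] intro!: always_eventually)
      moreover have "((\<lambda>t. z t - x t) \<longlongrightarrow> z a - x a) (at_right a)"
        using rc by (intro tendsto_diff) (auto simp: continuous_within)
      ultimately have "(\<lambda>n. z (c n) - x (c n)) \<longlonglongrightarrow> w"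
        unfolding w_def by (rule filterlim_compose[rotated])
      moreover have "z (c n) - x (c n) = 0" for n
        using gap[of "c n"] c[of n] d by (simp add: c_def)
      ultimately show False using False by (simp add: LIMSEQ_const_iff)
    qed
    then have mc: "mix_coeff \<eta> \<eta>' a b = transfer \<eta> g a b"
      unfolding mix_coeff_def g_def[abs_def] by (rule if_not_P)
    have mc': "mix_coeff' \<eta> \<eta>' a b = \<rho> / (1 - mix_coeff \<eta> \<eta>' a b)"
      by (simp add: mix_coeff'_def \<rho>_def g_def[abs_def])
    have y: "y = x a + mix_coeff \<eta> \<eta>' a b *\<^sub>R w" using fx mc by simp
    have yz: "y - z a = - ((1 - mix_coeff \<eta> \<eta>' a b) *\<^sub>R w)"
      by (simp add: y w_def algebra_simps)
    have "y' = z a + mix_coeff' \<eta> \<eta>' a b *\<^sub>R (y - z a)"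
      if cond: "(\<forall>t>0. \<eta>' t \<ge> 0) \<or> mix_coeff \<eta> \<eta>' a b \<noteq> 1"
    proof (cases "mix_coeff \<eta> \<eta>' a b = 1")
      case False
      then show ?thesis by (simp add: yz mc' fz(1))
    next
      \<comment> \<open>Here \<open>y = z a\<close>, so \<open>y' - y\<close> is
        \<open>- \<rho>\<close> times \<open>w\<close>. As a left limit of nonnegative multiples of
        \<open>w\<close> it forces \<open>\<rho> \<le> 0\<close>, whereas a nonnegative
        \<open>\<eta>'\<close> gives \<open>\<rho> \<ge> 0\<close>. Hence \<open>\<rho> = 0\<close>
        and \<open>z\<close> does not move.\<close>
      case True
      then have pos: "\<And>t. t > 0 \<Longrightarrow> \<eta>' t \<ge> 0" using cond by auto
      have "0 \<le> (LBINT u:{a..c}. \<eta>' u * decay g a u)" for c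
        unfolding set_lebesgue_integral_def
      proof (rule integral_nonneg_AE)
        show "AE u in lborel. 0 \<le> indicat_real {a..c} u *\<^sub>R (\<eta>' u * decay g a u)"
          using AE_lborel_singleton[of 0]
          by eventually_elim (use ab pos in \<open>auto simp: decay_nonneg indicator_def\<close>)
      qed
      then have "0 \<le> \<rho>"
        by (intro LIMSEQ_le_const[OF fz(2)]) auto
      have "((\<lambda>t. (z t - x t) \<bullet> w) \<longlongrightarrow> (y' - y) \<bullet> w) (at_left b)"
        by (intro tendsto_intros lim)
      then have "0 \<le> (y' - y) \<bullet> w"
      proof (rule tendsto_lowerbound)
        show "\<forall>\<^sub>F t in at_left b. 0 \<le> (z t - x t) \<bullet> w"
          using eventually_at_left_real[OF ab(2)] by eventually_elim (simp add: gap decay_nonneg)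
      qed auto
      also have "y' - y = - \<rho> *\<^sub>R w"
        using yz True by (simp add: fz(1))
      finally have "\<rho> * (w \<bullet> w) \<le> 0" by simp
      moreover have "w \<bullet> w > 0" using \<open>w \<noteq> 0\<close> by simp
      ultimately have "\<rho> \<le> 0" by (simp add: mult_le_0_iff)
      with \<open>0 \<le> \<rho>\<close> have "\<rho> = 0" by simp
      then show ?thesis by (simp add: fz(1) mc')
    qed
    then show ?thesis using y by blast
  qed
  show "y = x a + mix_coeff \<eta> \<eta>' a b *\<^sub>R (z a - x a)" using * by (simp add: w_def)
  show "y' = z a + mix_coeff' \<eta> \<eta>' a b *\<^sub>R (y - z a)"
    if "(\<forall>t>0. \<eta>' t \<ge> 0) \<or> mix_coeff \<eta> \<eta>' a b \<noteq> 1" using * that by blast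
qed

section \<open>Closed forms of the coefficients for the two special choices of rates\<close>

lemma decay_cong:
  assumes "g \<in> borel_measurable borel" "g' \<in> borel_measurable borel"
    and eq: "\<And>u. u > 0 \<Longrightarrow> g u = g' u" and "0 \<le> s"
  shows "decay g s t = decay g' s t"
proof -
  note [measurable] = assms(1,2)
  have ae: "AE u\<in>{s..t} in lborel. g u = g' u"
    using AE_lborel_singleton[of 0] by eventually_elim (use eq \<open>0 \<le> s\<close> in auto)
  have "set_integrable lborel {s..t} g \<longleftrightarrow> set_integrable lborel {s..t} g'"
    using ae by (intro set_integrable_cong_AE) auto
  moreover have "(LBINT u:{s..t}. g u) = (LBINT u:{s..t}. g' u)"
    using ae by (intro set_lebesgue_integral_cong_AE) auto
  ultimately show ?thesis by (simp add: decay_def)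
qed

lemma transfer_cong:
  assumes [measurable]: "h \<in> borel_measurable borel" "h' \<in> borel_measurable borel"
      "g \<in> borel_measurable borel" "g' \<in> borel_measurable borel"
    and h: "\<And>u. u > 0 \<Longrightarrow> h u = h' u" and g: "\<And>u. u > 0 \<Longrightarrow> g u = g' u" and s: "0 \<le> s"
  shows "transfer h g s t = transfer h' g' s t"
proof -
  have d: "decay g s u = decay g' s u" for u
    using g s by (intro decay_cong) auto
  have "AE u\<in>{s..r} in lborel. h u * decay g s u = h' u * decay g' s u" for r
    using AE_lborel_singleton[of 0] by eventually_elim (use h s d in auto)
  then have "(LBINT u:{s..r}. h u * decay g s u) = (LBINT u:{s..r}. h' u * decay g' s u)" for r
    by (intro set_lebesgue_integral_cong_AE) auto
  then show ?thesis by (simp add: transfer_def)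
qed

text \<open>The special choices prescribe the rates at positive times only, while the first interval
  starts at 0; a single point is a null set and does not affect the integrals.\<close>

lemma mix_coeff_cong:
  assumes [measurable]: "\<eta> \<in> borel_measurable borel" "\<zeta> \<in> borel_measurable borel"
      "\<eta>' \<in> borel_measurable borel" "\<zeta>' \<in> borel_measurable borel"
    and eq: "\<And>u. u > 0 \<Longrightarrow> \<eta> u = \<zeta> u" "\<And>u. u > 0 \<Longrightarrow> \<eta>' u = \<zeta>' u" and s: "0 \<le> s"
  shows "mix_coeff \<eta> \<eta>' s t = mix_coeff \<zeta> \<zeta>' s t" "mix_coeff' \<eta> \<eta>' s t = mix_coeff' \<zeta> \<zeta>' s t"
proof -
  have d: "decay (\<lambda>u. \<eta> u + \<eta>' u) s r = decay (\<lambda>u. \<zeta> u + \<zeta>' u) s r" for r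
    using eq s by (intro decay_cong) auto
  have "transfer \<eta> (\<lambda>u. \<eta> u + \<eta>' u) s t = transfer \<zeta> (\<lambda>u. \<zeta> u + \<zeta>' u) s t"
    "transfer \<eta>' (\<lambda>u. \<eta> u + \<eta>' u) s t = transfer \<zeta>' (\<lambda>u. \<zeta> u + \<zeta>' u) s t"
    using eq s by (auto intro!: transfer_cong)
  with d show "mix_coeff \<eta> \<eta>' s t = mix_coeff \<zeta> \<zeta>' s t" "mix_coeff' \<eta> \<eta>' s t = mix_coeff' \<zeta> \<zeta>' s t"
    by (simp_all add: mix_coeff_def mix_coeff'_def)
qed

lemma set_integral_FTC_Icc:
  fixes F f :: "real \<Rightarrow> real"
  assumes "a \<le> b" and F: "\<And>x. a \<le> x \<Longrightarrow> x \<le> b \<Longrightarrow> (F has_real_derivative f x) (at x)"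
    and f: "continuous_on {a..b} f"
  shows "set_integrable lborel {a..b} f" "(LBINT x:{a..b}. f x) = F b - F a"
proof -
  show si: "set_integrable lborel {a..b} f"
    unfolding set_integrable_def using f by (rule borel_integrable_compact[OF compact_Icc])
  have "(f has_integral F b - F a) {a..b}"
    using assms(1) F by (intro fundamental_theorem_of_calculus)
      (auto simp: has_real_derivative_iff_has_vector_derivative[symmetric] intro: has_field_derivative_at_within)
  then show "(LBINT x:{a..b}. f x) = F b - F a"
    using set_borel_integral_eq_integral(2)[OF si] by (simp add: integral_unique)
qed

lemma transfer_eqI:
  assumes J: "\<And>r. s \<le> r \<Longrightarrow> r < t \<Longrightarrow> (LBINT u:{s..r}. h u * decay g s u) = J r"
    and cont: "isCont J t" and st: "s < t"
  shows "transfer h g s t = J t"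
proof -
  define b where "b n = t - (t - s) / real (Suc n)" for n
  have b: "s \<le> b n" "b n < t" for n
  proof -
    have "(t - s) / real (Suc n) \<le> t - s" "0 < (t - s) / real (Suc n)"
      using st divide_left_mono[of 1 "real (Suc n)" "t - s"] by simp_all
    then show "s \<le> b n" "b n < t" unfolding b_def by linarith+
  qed
  have "b \<longlonglongrightarrow> t - 0"
    unfolding b_def divide_inverse
    by (intro tendsto_diff tendsto_const tendsto_mult_right_zero LIMSEQ_inverse_real_of_nat)
  then have "(\<lambda>n. J (b n)) \<longlonglongrightarrow> J t"
    using cont by (simp add: isCont_tendsto_compose)
  then show ?thesis
    unfolding transfer_def using J[OF b] by (simp add: b_def limI)
qed

lemma decay_const:
  assumes "s \<le> t"
  shows "decay (\<lambda>_. k) s t = exp (- k * (t - s))"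
proof -
  have "((\<lambda>u. k * u) has_real_derivative k) (at x)" for x
    by (auto intro!: derivative_eq_intros)
  note F = set_integral_FTC_Icc[of s t "\<lambda>u. k * u" "\<lambda>_. k", OF assms this continuous_on_const]
  show ?thesis
    using F(1) unfolding decay_def F(2) by (simp add: algebra_simps)
qed

lemma mix_coeff_const:
  fixes c :: real
  assumes c: "c > 0" and st: "s < t"
  shows "mix_coeff (\<lambda>_. c) (\<lambda>_. c) s t = 1 / 2 * (1 - exp (- 2 * c * (t - s)))"
    and "mix_coeff' (\<lambda>_. c) (\<lambda>_. c) s t = tanh (c * (t - s))"
proof -
  have tr: "transfer (\<lambda>_. c) (\<lambda>_. c + c) s t = (1 - exp (- 2 * c * (t - s))) / 2"
  proof (rule transfer_eqI[OF _ _ st, where J="\<lambda>r. (1 - exp (- 2 * c * (r - s))) / 2"])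
    fix r assume r: "s \<le> r" "r < t"
    have "(LBINT u:{s..r}. c * decay (\<lambda>_. c + c) s u) = (LBINT u:{s..r}. c * exp (- 2 * c * (u - s)))"
      by (intro set_lebesgue_integral_cong) (auto simp: decay_const)
    also have "\<dots> = (1 - exp (- 2 * c * (r - s))) / 2 - (1 - exp (- 2 * c * (s - s))) / 2"
      by (rule set_integral_FTC_Icc(2)[OF r(1)])
        (auto intro!: derivative_eq_intros continuous_intros)
    finally show "(LBINT u:{s..r}. c * decay (\<lambda>_. c + c) s u) = (1 - exp (- 2 * c * (r - s))) / 2"
      by simp
  qed (auto intro!: continuous_intros)
  have nd: "decay (\<lambda>_. c + c) s (s + (t - s) / real (n + 2)) \<noteq> 0" for n
    using st by (subst decay_const) auto
  then show 1: "mix_coeff (\<lambda>_. c) (\<lambda>_. c) s t = 1 / 2 * (1 - exp (- 2 * c * (t - s)))"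
    unfolding mix_coeff_def tr by simp
  show "mix_coeff' (\<lambda>_. c) (\<lambda>_. c) s t = tanh (c * (t - s))"
  proof -
    define E where "E = exp (- 2 * c * (t - s))"
    have "0 < E" by (simp add: E_def)
    have "mix_coeff' (\<lambda>_. c) (\<lambda>_. c) s t = ((1 - E) / 2) / (1 - (1 - E) / 2)"
      unfolding mix_coeff'_def 1 tr E_def by simp
    also have "\<dots> = (1 - E) / (1 + E)" using \<open>0 < E\<close> by (simp add: field_simps)
    also have "\<dots> = tanh (c * (t - s))"
      by (simp add: tanh_real_altdef E_def mult.assoc)
    finally show ?thesis .
  qed
qed

lemma set_integral_two_over:
  fixes s t :: real
  assumes "0 < s" "s \<le> t"
  shows "set_integrable lborel {s..t} (\<lambda>u. 2 / u)" "(LBINT u:{s..t}. 2 / u) = 2 * ln t - 2 * ln s"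
proof -
  have "((\<lambda>u. 2 * ln u) has_real_derivative 2 / u) (at u)" if "s \<le> u" for u :: real
    using that assms by (auto intro!: derivative_eq_intros)
  moreover have "continuous_on {s..t} (\<lambda>u. 2 / u)"
    using assms by (intro continuous_intros) auto
  ultimately show "set_integrable lborel {s..t} (\<lambda>u. 2 / u)" "(LBINT u:{s..t}. 2 / u) = 2 * ln t - 2 * ln s"
    using set_integral_FTC_Icc[of s t "\<lambda>u. 2 * ln u" "\<lambda>u. 2 / u"] assms(2) by blast+
qed

lemma decay_two_over_pos:
  assumes "0 < s" "s \<le> t"
  shows "decay (\<lambda>u. 2 / u) s t = (s / t)\<^sup>2"
proof -
  note si = set_integral_two_over[OF assms]
  have "exp (- (2 * ln t - 2 * ln s)) = exp (ln s - ln t) * exp (ln s - ln t)"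
    by (simp flip: exp_add)
  also have "\<dots> = (s / t)\<^sup>2"
    using assms by (simp add: exp_diff power2_eq_square)
  finally show ?thesis using si by (simp add: decay_def)
qed

lemma decay_two_over_zero:
  assumes "0 < t"
  shows "decay (\<lambda>u. 2 / u) 0 t = 0"
proof -
  have "\<not> set_integrable lborel {0..t} (\<lambda>u. 2 / u)"
  proof
    assume "set_integrable lborel {0..t} (\<lambda>u. 2 / u :: real)"
    then have int: "(\<lambda>u. 2 / u) integrable_on {0..t}" by (rule set_borel_integral_eq_integral(1))
    define C where "C = integral {0..t} (\<lambda>u::real. 2 / u)"
    \<comment> \<open>With this \<open>e\<close> the integral over \<open>{e..t}\<close> is
      \<open>2 * (\<bar>C\<bar> + 1)\<close>, which exceeds the supposed total
      \<open>C\<close>.\<close>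
    define e where "e = t * exp (- (\<bar>C\<bar> + 1))"
    have e: "0 < e" "e \<le> t" using assms by (auto simp: e_def)
    note si = set_integral_two_over[OF e]
    have "integral {e..t} (\<lambda>u. 2 / u) \<le> C"
      unfolding C_def using int e set_borel_integral_eq_integral(1)[OF si(1)]
      by (intro integral_subset_le) auto
    moreover have "integral {e..t} (\<lambda>u. 2 / u) = 2 * ln t - 2 * ln e"
      using si set_borel_integral_eq_integral(2)[OF si(1)] by simp
    moreover have "ln e = ln t - (\<bar>C\<bar> + 1)"
      using assms by (simp add: e_def ln_mult)
    ultimately show False by simp
  qed
  then show ?thesis by (simp add: decay_def)
qed

lemma mix_coeff_two_over:
  assumes s: "0 \<le> s" and st: "s < t"
  shows "mix_coeff (\<lambda>u. 2 / u) (\<lambda>_. 0) s t = 1 - (s / t)\<^sup>2"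
    and "mix_coeff' (\<lambda>u. 2 / u) (\<lambda>_. 0) s t = 0"
proof -
  have pos: "0 < (t - s) / real (n + 2)" for n using st by simp
  show "mix_coeff (\<lambda>u. 2 / u) (\<lambda>_. 0) s t = 1 - (s / t)\<^sup>2"
  proof (cases "s = 0")
    case True
    then have "decay (\<lambda>u. 2 / u) s (s + (t - s) / real (n + 2)) = 0" for n
      using decay_two_over_zero[of "s + (t - s) / real (n + 2)"] pos[of n] by simp
    with True show ?thesis by (simp add: mix_coeff_def)
  next
    case False
    with s have s: "0 < s" by simp
    have "decay (\<lambda>u. 2 / u) s (s + (t - s) / real (n + 2)) \<noteq> 0" for n
      using s pos[of n] by (subst decay_two_over_pos) auto
    moreover have "transfer (\<lambda>u. 2 / u) (\<lambda>u. 2 / u) s t = 1 - (s / t)\<^sup>2"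
    proof (rule transfer_eqI[OF _ _ st, where J="\<lambda>r. 1 - (s / r)\<^sup>2"])
      fix r assume r: "s \<le> r" "r < t"
      have "(LBINT u:{s..r}. 2 / u * decay (\<lambda>u. 2 / u) s u) = (LBINT u:{s..r}. 2 / u * (s / u)\<^sup>2)"
        using s by (intro set_lebesgue_integral_cong) (auto simp: decay_two_over_pos)
      also have "\<dots> = (1 - (s / r)\<^sup>2) - (1 - (s / s)\<^sup>2)"
        using s by (intro set_integral_FTC_Icc(2)[OF r(1)])
          (auto intro!: derivative_eq_intros continuous_intros simp: field_simps power2_eq_square)
      finally show "(LBINT u:{s..r}. 2 / u * decay (\<lambda>u. 2 / u) s u) = 1 - (s / r)\<^sup>2"
        using s by simp
    qed (use s st in \<open>auto intro!: continuous_intros\<close>)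
    ultimately show ?thesis by (simp add: mix_coeff_def)
  qed
  show "mix_coeff' (\<lambda>u. 2 / u) (\<lambda>_. 0) s t = 0"
    by (simp add: mix_coeff'_def transfer_def set_lebesgue_integral_def)
qed

section \<open>Chains driven by exponential waiting times\<close>

text \<open>Dynkin's formula for one exponential clock: \<open>\<psi>\<close> follows the flow and \<open>q\<close> is the value after a jump, so the
  drift inequality makes \<open>exp (- \<delta>) * \<psi> (s + \<delta>)\<close> decrease at least at the rate \<open>exp (- \<delta>) * q (s + \<delta>)\<close>.\<close>

lemma nn_integral_exponential_le:
  fixes \<psi> \<psi>' q :: "real \<Rightarrow> real"
  assumes deriv: "\<And>u. s \<le> u \<Longrightarrow> (\<psi> has_real_derivative \<psi>' u) (at u)"
    and nonneg: "\<And>u. s \<le> u \<Longrightarrow> 0 \<le> \<psi> u" "\<And>u. s \<le> u \<Longrightarrow> 0 \<le> q u"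
    and drift: "\<And>u. s \<le> u \<Longrightarrow> \<psi>' u + q u \<le> \<psi> u"
    and meas: "\<psi> \<in> borel_measurable borel" "\<psi>' \<in> borel_measurable borel"
  shows "(\<integral>\<^sup>+\<delta>. ennreal (exponential_density 1 \<delta>) * ennreal (q (s + \<delta>)) \<partial>lborel) \<le> ennreal (\<psi> s)"
proof -
  define F where "F \<delta> = - exp (- \<delta>) * \<psi> (s + \<delta>)" for \<delta>
  define D where "D \<delta> = exp (- \<delta>) * (\<psi> (s + \<delta>) - \<psi>' (s + \<delta>))" for \<delta>
  have D: "(F has_real_derivative D \<delta>) (at \<delta>)" if "0 \<le> \<delta>" for \<delta>
  proof -
    have "((\<lambda>\<delta>. \<psi> (\<delta> + s)) has_real_derivative \<psi>' (s + \<delta>)) (at \<delta>)"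
      using DERIV_shift[of \<psi> "\<psi>' (s + \<delta>)" \<delta> s] deriv[of "s + \<delta>"] that
      by (simp add: add.commute)
    then show ?thesis unfolding F_def[abs_def] D_def
      by (auto intro!: derivative_eq_intros simp: algebra_simps)
  qed
  have D0: "0 \<le> exp (- \<delta>) * q (s + \<delta>)" "exp (- \<delta>) * q (s + \<delta>) \<le> D \<delta>" if "0 \<le> \<delta>" for \<delta>
    using drift[of "s + \<delta>"] nonneg(2)[of "s + \<delta>"] that by (auto simp: D_def)
  have mono: "F x \<le> F y" if "0 \<le> x" "x \<le> y" for x y
  proof (rule DERIV_nonneg_imp_nondecreasing[OF that(2)])
    fix u assume "x \<le> u" "u \<le> y"
    then have "0 \<le> u" using that by simp
    with D[OF this] D0[OF this] show "\<exists>y. (F has_real_derivative y) (at u) \<and> 0 \<le> y"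
      by (meson order_trans)
  qed
  have F0: "F x \<le> 0" if "0 \<le> x" for x
    using nonneg(1)[of "s + x"] that by (simp add: F_def)
  \<comment> \<open>No growth control on \<open>\<psi>\<close> is available, so the boundary term at
    infinity comes from monotonicity: \<open>F\<close> is nondecreasing and bounded above by 0. Its
    limit is nonpositive, and \<open>- F 0\<close> is \<open>\<psi> s\<close>.\<close>
  obtain l where l: "(F \<longlongrightarrow> l) at_top"
  proof (rule that)
    show "(F \<longlongrightarrow> (SUP x\<in>{0..}. F x)) at_top"
    proof (rule increasing_tendsto)
      have bdd: "bdd_above (F ` {0..})" using F0 by (auto intro!: bdd_aboveI[of _ 0])
      show "\<forall>\<^sub>F n in at_top. F n \<le> (SUP x\<in>{0..}. F x)"
        using eventually_ge_at_top[of 0] by eventually_elim (auto intro!: cSUP_upper bdd)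
      fix x assume "x < (SUP x\<in>{0..}. F x)"
      then obtain y where y: "0 \<le> y" "x < F y"
        using less_cSUP_iff[OF _ bdd] by auto
      show "\<forall>\<^sub>F n in at_top. x < F n"
        using eventually_ge_at_top[of y] by eventually_elim (use y mono in \<open>auto intro: less_le_trans\<close>)
    qed
  qed
  have "l \<le> 0"
    by (rule tendsto_upperbound[OF l]) (auto intro!: eventually_mono[OF eventually_ge_at_top[of 0]] F0)
  have "(\<integral>\<^sup>+\<delta>. ennreal (exponential_density 1 \<delta>) * ennreal (q (s + \<delta>)) \<partial>lborel)
      \<le> (\<integral>\<^sup>+\<delta>. ennreal (D \<delta>) * indicator {0..} \<delta> \<partial>lborel)"
    using D0 nonneg(2)
    by (intro nn_integral_mono)
      (auto simp: exponential_density_def ennreal_mult'[symmetric] split: split_indicator intro!: ennreal_leI)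
  also have "\<dots> = ennreal (l - F 0)"
  proof (intro nn_integral_FTC_atLeast)
    show "D \<in> borel_measurable borel" unfolding D_def[abs_def] using meas by measurable
    show "0 \<le> D x" if "0 \<le> x" for x using D0[OF that] by simp
  qed (use D l in auto)
  also have "\<dots> \<le> ennreal (\<psi> s)"
    using \<open>l \<le> 0\<close> by (intro ennreal_leI) (simp add: F_def)
  finally show ?thesis .
qed

text \<open>The noise enters as an argument: the state after \<open>k\<close> steps is a
  deterministic function of the entries of \<open>d\<close> below \<open>k\<close>. Independence of
  the next waiting time from the current state can then be read off from the index sets.\<close>

primrec driven_chain :: "('s \<Rightarrow> real \<Rightarrow> 's) \<Rightarrow> 's \<Rightarrow> nat \<Rightarrow> (nat \<Rightarrow> real) \<Rightarrow> 's" where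
  "driven_chain F s0 0 d = s0"
| "driven_chain F s0 (Suc k) d = F (driven_chain F s0 k d) (d k)"

lemma driven_chain_cong:
  "(\<And>i. i < k \<Longrightarrow> d i = d' i) \<Longrightarrow> driven_chain F s0 k d = driven_chain F s0 k d'"
  by (induction k) auto

lemma measurable_driven_chain:
  assumes F: "case_prod F \<in> N \<Otimes>\<^sub>M borel \<rightarrow>\<^sub>M N" and s0: "s0 \<in> space N"
    and "k \<le> n"
  shows "driven_chain F s0 k \<in> PiM {..<n} (\<lambda>_. borel) \<rightarrow>\<^sub>M N"
  using \<open>k \<le> n\<close>
proof (induction k)
  case 0
  then show ?case using s0 by (simp cong: measurable_cong)
next
  case (Suc k)
  have "(\<lambda>d. d k) \<in> PiM {..<n} (\<lambda>_. borel :: real measure) \<rightarrow>\<^sub>M borel"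
    using Suc.prems by (intro measurable_component_singleton) auto
  with Suc have "(\<lambda>d. (driven_chain F s0 k d, d k)) \<in> PiM {..<n} (\<lambda>_. borel) \<rightarrow>\<^sub>M N \<Otimes>\<^sub>M borel"
    by (intro measurable_Pair) auto
  from measurable_compose[OF this F] show ?case by simp
qed

text \<open>The current state depends on the first \<open>k\<close> waiting times and is independent
  of the next one, so by Fubini the next one is integrated first, with the state frozen; this is the
  integral bounded in \<open>step\<close>. The set \<open>I\<close> carries pathwise invariants,
  such as nonnegativity of time, into that one-step bound.\<close>

lemma (in prob_space) nn_integral_driven_chain_le:
  assumes indep: "indep_vars (\<lambda>_. borel) D UNIV"
    and exp: "\<And>k. distributed M lborel (D k) (exponential_density 1)"
    and F: "case_prod F \<in> N \<Otimes>\<^sub>M borel \<rightarrow>\<^sub>M N" and s0: "s0 \<in> space N"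
    and \<Phi>: "\<Phi> \<in> borel_measurable N"
    and inv: "\<And>k \<omega>. \<omega> \<in> space M \<Longrightarrow> driven_chain F s0 k (\<lambda>i. D i \<omega>) \<in> I"
    and step: "\<And>s. s \<in> I \<Longrightarrow> s \<in> space N \<Longrightarrow>
      (\<integral>\<^sup>+\<delta>. ennreal (exponential_density 1 \<delta>) * \<Phi> (F s \<delta>) \<partial>lborel) \<le> \<Phi> s"
  shows "(\<integral>\<^sup>+\<omega>. \<Phi> (driven_chain F s0 k (\<lambda>i. D i \<omega>)) \<partial>M) \<le> \<Phi> s0"
proof (induction k)
  case 0
  then show ?case by (simp add: emeasure_space_1)
next
  case (Suc k)
  let ?S = "\<lambda>\<omega>. driven_chain F s0 k (\<lambda>i. D i \<omega>)"
  have D_meas: "D i \<in> borel_measurable M" for i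
    using indep by (auto simp: indep_vars_def)
  have restr: "(\<lambda>\<omega>. \<lambda>i\<in>{..<k}. D i \<omega>) \<in> M \<rightarrow>\<^sub>M PiM {..<k} (\<lambda>_. borel)"
    using D_meas by (intro measurable_restrict) auto
  have S_eq: "?S \<omega> = driven_chain F s0 k (\<lambda>i\<in>{..<k}. D i \<omega>)" for \<omega>
    by (rule driven_chain_cong) simp
  have S_meas: "?S \<in> M \<rightarrow>\<^sub>M N"
    unfolding S_eq using measurable_compose[OF restr measurable_driven_chain[OF F s0 order_refl]] .
  \<comment> \<open>Independence is used for blocks of coordinates, so the next waiting time appears
    as a function on the index set \<open>{k}\<close> and is later unpacked by evaluation at
    \<open>k\<close>.\<close>
  have "indep_var (PiM {..<k} (\<lambda>_. borel)) (\<lambda>\<omega>. \<lambda>i\<in>{..<k}. D i \<omega>)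
      (PiM {k} (\<lambda>_. borel)) (\<lambda>\<omega>. \<lambda>i\<in>{k}. D i \<omega>)"
    by (rule indep_var_restrict[OF indep]) auto
  then have joint: "distr M (PiM {..<k} (\<lambda>_. borel) \<Otimes>\<^sub>M PiM {k} (\<lambda>_. borel))
        (\<lambda>\<omega>. (\<lambda>i\<in>{..<k}. D i \<omega>, \<lambda>i\<in>{k}. D i \<omega>))
      = distr M (PiM {..<k} (\<lambda>_. borel)) (\<lambda>\<omega>. \<lambda>i\<in>{..<k}. D i \<omega>)
        \<Otimes>\<^sub>M distr M (PiM {k} (\<lambda>_. borel)) (\<lambda>\<omega>. \<lambda>i\<in>{k}. D i \<omega>)"
    by (simp add: indep_var_distribution_eq)
  have Dk: "distr M borel (D k) = density lborel (exponential_density 1)"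
    using exp[of k] by (simp add: distributed_def cong: distr_cong)
  have restr': "(\<lambda>\<omega>. \<lambda>i\<in>{k}. D i \<omega>) \<in> M \<rightarrow>\<^sub>M PiM {k} (\<lambda>_. borel)"
    using D_meas by (intro measurable_restrict) auto
  interpret R: prob_space "distr M (PiM {k} (\<lambda>_. borel)) (\<lambda>\<omega>. \<lambda>i\<in>{k}. D i \<omega>)"
    using restr' by (rule prob_space_distr)
  have chain: "driven_chain F s0 k \<in> PiM {..<k} (\<lambda>_. borel) \<rightarrow>\<^sub>M N"
    by (rule measurable_driven_chain[OF F s0 order_refl])
  have comp: "(\<lambda>d. d k) \<in> PiM {k} (\<lambda>_. borel :: real measure) \<rightarrow>\<^sub>M borel"
    by (rule measurable_component_singleton) simp
  have [measurable]: "case_prod F \<in> N \<Otimes>\<^sub>M borel \<rightarrow>\<^sub>M N" "\<Phi> \<in> borel_measurable N" "D k \<in> borel_measurable M"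
    using F \<Phi> D_meas by auto
  have "(\<lambda>p. (driven_chain F s0 k (fst p), snd p k))
      \<in> PiM {..<k} (\<lambda>_. borel) \<Otimes>\<^sub>M PiM {k} (\<lambda>_. borel) \<rightarrow>\<^sub>M N \<Otimes>\<^sub>M (borel :: real measure)"
    by (rule measurable_Pair[OF measurable_compose[OF measurable_fst chain] measurable_compose[OF measurable_snd comp]])
  from measurable_compose[OF measurable_compose[OF this F] \<Phi>]
  have meas: "(\<lambda>p. \<Phi> (F (driven_chain F s0 k (fst p)) (snd p k)))
      \<in> borel_measurable (PiM {..<k} (\<lambda>_. borel) \<Otimes>\<^sub>M PiM {k} (\<lambda>_. borel))"
    by simp
  have F_section: "F s \<in> borel \<rightarrow>\<^sub>M N" if "s \<in> space N" for s
    using measurable_compose[OF measurable_Pair1'[OF that] F] by simp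
  have "(\<integral>\<^sup>+\<omega>. \<Phi> (driven_chain F s0 (Suc k) (\<lambda>i. D i \<omega>)) \<partial>M)
      = (\<integral>\<^sup>+p. \<Phi> (F (driven_chain F s0 k (fst p)) (snd p k))
          \<partial>distr M (PiM {..<k} (\<lambda>_. borel) \<Otimes>\<^sub>M PiM {k} (\<lambda>_. borel))
            (\<lambda>\<omega>. (\<lambda>i\<in>{..<k}. D i \<omega>, \<lambda>i\<in>{k}. D i \<omega>)))"
  proof (subst nn_integral_distr)
    show "(\<lambda>\<omega>. (\<lambda>i\<in>{..<k}. D i \<omega>, \<lambda>i\<in>{k}. D i \<omega>)) \<in> M \<rightarrow>\<^sub>M PiM {..<k} (\<lambda>_. borel) \<Otimes>\<^sub>M PiM {k} (\<lambda>_. borel)"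
      using restr restr' by (rule measurable_Pair)
    show "(\<lambda>p. \<Phi> (F (driven_chain F s0 k (fst p)) (snd p k)))
        \<in> borel_measurable (distr M (PiM {..<k} (\<lambda>_. borel) \<Otimes>\<^sub>M PiM {k} (\<lambda>_. borel))
          (\<lambda>\<omega>. (\<lambda>i\<in>{..<k}. D i \<omega>, \<lambda>i\<in>{k}. D i \<omega>)))"
      unfolding measurable_distr_eq1 by (rule meas)
  qed (simp only: driven_chain.simps S_eq fst_conv snd_conv restrict_apply' singletonI)
  also have "\<dots> = (\<integral>\<^sup>+d. \<integral>\<^sup>+d'. \<Phi> (F (driven_chain F s0 k d) (d' k))
        \<partial>distr M (PiM {k} (\<lambda>_. borel)) (\<lambda>\<omega>. \<lambda>i\<in>{k}. D i \<omega>)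
        \<partial>distr M (PiM {..<k} (\<lambda>_. borel)) (\<lambda>\<omega>. \<lambda>i\<in>{..<k}. D i \<omega>))"
    unfolding joint using meas
    by (subst R.nn_integral_fst[symmetric]) (simp_all cong: measurable_cong_sets)
  also have "\<dots> = (\<integral>\<^sup>+d. \<integral>\<^sup>+\<delta>. \<Phi> (F (driven_chain F s0 k d) \<delta>) \<partial>distr M borel (D k)
        \<partial>distr M (PiM {..<k} (\<lambda>_. borel)) (\<lambda>\<omega>. \<lambda>i\<in>{..<k}. D i \<omega>))"
  proof (rule nn_integral_cong)
    fix d assume "d \<in> space (distr M (PiM {..<k} (\<lambda>_. borel)) (\<lambda>\<omega>. \<lambda>i\<in>{..<k}. D i \<omega>))"
    then have "driven_chain F s0 k d \<in> space N"
      using chain by (auto dest: measurable_space)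
    then have F': "(\<lambda>\<delta>. \<Phi> (F (driven_chain F s0 k d) \<delta>)) \<in> borel_measurable borel"
      by (intro measurable_compose[OF F_section \<Phi>])
    show "(\<integral>\<^sup>+d'. \<Phi> (F (driven_chain F s0 k d) (d' k)) \<partial>distr M (PiM {k} (\<lambda>_. borel)) (\<lambda>\<omega>. \<lambda>i\<in>{k}. D i \<omega>))
        = (\<integral>\<^sup>+\<delta>. \<Phi> (F (driven_chain F s0 k d) \<delta>) \<partial>distr M borel (D k))"
      using restr' measurable_compose[OF comp F'] F'
      by (simp add: nn_integral_distr)
  qed
  also have "\<dots> = (\<integral>\<^sup>+\<omega>. \<integral>\<^sup>+\<delta>. \<Phi> (F (?S \<omega>) \<delta>) \<partial>distr M borel (D k) \<partial>M)"
  proof (subst nn_integral_distr[OF restr])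
    interpret Dk: prob_space "distr M borel (D k)"
      using D_meas by (rule prob_space_distr)
    have "(\<lambda>p. \<Phi> (case_prod F p)) \<in> borel_measurable (N \<Otimes>\<^sub>M distr M borel (D k))"
      by (simp cong: measurable_cong_sets)
    then have "(\<lambda>s. \<integral>\<^sup>+\<delta>. \<Phi> (F s \<delta>) \<partial>distr M borel (D k)) \<in> borel_measurable N"
      using Dk.borel_measurable_nn_integral_fst[of "\<lambda>p. \<Phi> (case_prod F p)" N] by simp
    from measurable_compose[OF chain this]
    show "(\<lambda>d. \<integral>\<^sup>+\<delta>. \<Phi> (F (driven_chain F s0 k d) \<delta>) \<partial>distr M borel (D k))
        \<in> borel_measurable (distr M (PiM {..<k} (\<lambda>_. borel)) (\<lambda>\<omega>. \<lambda>i\<in>{..<k}. D i \<omega>))"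
      by simp
  qed (simp only: S_eq)
  also have "\<dots> \<le> (\<integral>\<^sup>+\<omega>. \<Phi> (?S \<omega>) \<partial>M)"
  proof (rule nn_integral_mono)
    fix \<omega> assume \<omega>: "\<omega> \<in> space M"
    then have sp: "?S \<omega> \<in> space N" using S_meas by (auto dest: measurable_space)
    have [measurable]: "F (?S \<omega>) \<in> borel \<rightarrow>\<^sub>M N"
      using sp by (rule F_section)
    have "(\<integral>\<^sup>+\<delta>. \<Phi> (F (?S \<omega>) \<delta>) \<partial>distr M borel (D k))
        = (\<integral>\<^sup>+\<delta>. ennreal (exponential_density 1 \<delta>) * \<Phi> (F (?S \<omega>) \<delta>) \<partial>lborel)"
      unfolding Dk by (subst nn_integral_density) auto
    also have "\<dots> \<le> \<Phi> (?S \<omega>)" using step inv[OF \<omega>] sp by blast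
    finally show "(\<integral>\<^sup>+\<delta>. \<Phi> (F (?S \<omega>) \<delta>) \<partial>distr M borel (D k)) \<le> \<Phi> (?S \<omega>)" .
  qed
  also note Suc
  finally show ?case .
qed

text \<open>The process is known to be measurable at deterministic times only. Approximating
  \<open>S\<close> from the right by times with countably many values reduces the claim to these,
  and right continuity gives the limit.\<close>

lemma borel_measurable_right_continuous_eval:
  fixes X :: "real \<Rightarrow> 'w \<Rightarrow> 'b::metric_space"
  assumes X: "\<And>t. t \<ge> 0 \<Longrightarrow> X t \<in> borel_measurable M"
    and rc: "\<And>\<omega> t. \<omega> \<in> space M \<Longrightarrow> t \<ge> 0 \<Longrightarrow> continuous (at_right t) (\<lambda>t. X t \<omega>)"
    and S [measurable]: "S \<in> borel_measurable M" and S0: "\<And>\<omega>. \<omega> \<in> space M \<Longrightarrow> S \<omega> \<ge> 0"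
  shows "(\<lambda>\<omega>. X (S \<omega>) \<omega>) \<in> borel_measurable M"
proof (rule borel_measurable_LIMSEQ_metric)
  \<comment> \<open>The summand 1 puts the grid time strictly above \<open>S \<omega>\<close>, also
    when \<open>S \<omega>\<close> is itself a grid point, so that the limit along
    \<open>at_right\<close> applies.\<close>
  define m where "m n \<omega> = nat \<lfloor>real (Suc n) * S \<omega>\<rfloor> + 1" for n \<omega>
  define A where "A n \<omega> = real (m n \<omega>) / real (Suc n)" for n \<omega>
  have [measurable]: "m n \<in> M \<rightarrow>\<^sub>M count_space UNIV" for n
    unfolding m_def by measurable
  show "(\<lambda>\<omega>. X (A n \<omega>) \<omega>) \<in> borel_measurable M" for n
    unfolding A_def
    by (rule measurable_compose_countable[of "\<lambda>i. X (real i / real (Suc n))" M borel "m n"]) (auto intro!: X)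
  fix \<omega> assume \<omega>: "\<omega> \<in> space M"
  have A: "S \<omega> < A n \<omega>" "A n \<omega> \<le> S \<omega> + 1 / real (Suc n)" for n
  proof -
    define r where "r = real (Suc n) * S \<omega>"
    have "0 \<le> r" using S0[OF \<omega>] by (simp add: r_def)
    then have "real (m n \<omega>) = of_int \<lfloor>r\<rfloor> + 1" by (simp add: m_def r_def)
    then have "r < real (m n \<omega>)" "real (m n \<omega>) \<le> r + 1" by linarith+
    moreover have "S \<omega> = r / real (Suc n)" by (simp add: r_def)
    ultimately show "S \<omega> < A n \<omega>" "A n \<omega> \<le> S \<omega> + 1 / real (Suc n)"
      unfolding A_def by (auto simp: divide_strict_right_mono divide_right_mono simp flip: add_divide_distrib)
  qed
  have "(\<lambda>n. A n \<omega>) \<longlonglongrightarrow> S \<omega>"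
  proof (rule tendsto_sandwich[of "\<lambda>_. S \<omega>" _ _ "\<lambda>n. S \<omega> + 1 / real (Suc n)"])
    show "(\<lambda>n. S \<omega> + 1 / real (Suc n)) \<longlonglongrightarrow> S \<omega>"
      using tendsto_add[OF tendsto_const LIMSEQ_inverse_real_of_nat, of "S \<omega>"] by (simp add: inverse_eq_divide)
  qed (use A in \<open>auto intro!: always_eventually less_imp_le\<close>)
  then have "filterlim (\<lambda>n. A n \<omega>) (at_right (S \<omega>)) sequentially"
    using less_imp_neq[OF A(1), symmetric] A(1) by (auto simp: filterlim_at intro!: always_eventually)
  moreover have "((\<lambda>t. X t \<omega>) \<longlongrightarrow> X (S \<omega>) \<omega>) (at_right (S \<omega>))"
    using rc[OF \<omega> S0[OF \<omega>]] by (simp add: continuous_within)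
  ultimately show "(\<lambda>n. X (A n \<omega>) \<omega>) \<longlonglongrightarrow> X (S \<omega>) \<omega>"
    by (rule filterlim_compose[rotated])
qed

section \<open>Lyapunov functions\<close>

lemma gderiv_grad:
  fixes f :: "'a::euclidean_space \<Rightarrow> real"
  assumes "f differentiable (at x)"
  shows "GDERIV f x :> grad f x"
proof -
  obtain f' where f': "(f has_derivative f') (at x)"
    using assms by (auto simp: differentiable_def)
  \<comment> \<open>The Riesz representative of the linear functional \<open>f'\<close>.\<close>
  define D where "D = (\<Sum>b\<in>Basis. f' b *\<^sub>R b)"
  have "f' h = h \<bullet> D" for h
  proof -
    have "f' h = f' (\<Sum>b\<in>Basis. (h \<bullet> b) *\<^sub>R b)" by (simp add: euclidean_representation)
    also have "\<dots> = (\<Sum>b\<in>Basis. (h \<bullet> b) * f' b)"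
      using has_derivative_linear[OF f'] by (simp add: linear_sum linear_scale)
    also have "\<dots> = h \<bullet> D" by (simp add: D_def inner_sum_right mult.commute)
    finally show ?thesis .
  qed
  then have "GDERIV f x :> D" using f' by (simp add: gderiv_def has_derivative_eq_rhs ext)
  moreover have "D' = D" if "GDERIV f x :> D'" for D'
  proof -
    have "(\<lambda>h. h \<bullet> D') = (\<lambda>h. h \<bullet> D)"
      using that \<open>GDERIV f x :> D\<close> unfolding gderiv_def by (rule has_derivative_unique)
    then show ?thesis by (metis inner_commute vector_eq_rdot)
  qed
  ultimately show ?thesis unfolding grad_def by (metis theI)
qed

lemma has_derivative_grad:
  fixes f :: "'a::euclidean_space \<Rightarrow> real"
  assumes "f differentiable (at x)"
  shows "(f has_derivative (\<lambda>h. h \<bullet> grad f x)) (at x)"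
  using gderiv_grad[OF assms] by (simp add: gderiv_def)

lemma has_real_derivative_along:
  fixes f :: "'a::euclidean_space \<Rightarrow> real" and y :: "real \<Rightarrow> 'a"
  assumes f: "\<And>p. f differentiable (at p)" and y: "(y has_vector_derivative y') (at u)"
  shows "((\<lambda>u. f (y u)) has_real_derivative grad f (y u) \<bullet> y') (at u)"
proof -
  have "((\<lambda>u. f (y u)) has_derivative (\<lambda>h. (h *\<^sub>R y') \<bullet> grad f (y u))) (at u)"
    using has_derivative_compose[OF y[unfolded has_vector_derivative_def] has_derivative_grad[OF f]] .
  then show ?thesis
    by (rule has_derivative_imp_has_field_derivative) (simp add: inner_commute)
qed

text \<open>Each coordinate of the gradient is a pointwise limit of difference quotients of the
  continuous function \<open>f\<close>. This is what makes the jump chain measurable.\<close>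

lemma borel_measurable_grad:
  fixes f :: "'a::euclidean_space \<Rightarrow> real"
  assumes f: "\<And>p. f differentiable (at p)"
  shows "grad f \<in> borel_measurable borel"
proof (subst borel_measurable_euclidean_space, rule ballI)
  fix e :: 'a assume "e \<in> Basis"
  have cont: "continuous_on UNIV f"
    using f by (simp add: continuous_on_eq_continuous_at differentiable_imp_continuous_within)
  then have [measurable]: "f \<in> borel_measurable borel" by (rule borel_measurable_continuous_onI)
  show "(\<lambda>p. grad f p \<bullet> e) \<in> borel_measurable borel"
  proof (rule borel_measurable_LIMSEQ_real)
    fix p
    have "((\<lambda>u. p + u *\<^sub>R e) has_vector_derivative e) (at 0)"
      by (auto intro!: derivative_eq_intros)
    from has_real_derivative_along[OF f this]
    have "((\<lambda>h. (f (p + h *\<^sub>R e) - f p) / h) \<longlongrightarrow> grad f p \<bullet> e) (at 0)"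
      by (simp add: DERIV_def)
    moreover have "filterlim (\<lambda>n. inverse (real (Suc n))) (at 0) sequentially"
      using LIMSEQ_inverse_real_of_nat by (auto simp: filterlim_at intro!: always_eventually)
    ultimately show "(\<lambda>n. (f (p + inverse (real (Suc n)) *\<^sub>R e) - f p) / inverse (real (Suc n)))
        \<longlonglongrightarrow> grad f p \<bullet> e"
      by (rule filterlim_compose)
  next
    show "(\<lambda>p. (f (p + inverse (real (Suc n)) *\<^sub>R e) - f p) / inverse (real (Suc n))) \<in> borel_measurable borel" for n
      by measurable
  qed
qed

lemma convex_grad_le:
  fixes f :: "'a::euclidean_space \<Rightarrow> real"
  assumes conv: "convex_on UNIV f" and f: "\<And>p. f differentiable (at p)"
  shows "f y + grad f y \<bullet> (x - y) \<le> f x"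
proof -
  have "((\<lambda>u. y + u *\<^sub>R (x - y)) has_vector_derivative (x - y)) (at 0)"
    by (auto intro!: derivative_eq_intros)
  from has_real_derivative_along[OF f this]
  have "((\<lambda>h. (f (y + h *\<^sub>R (x - y)) - f y) / h) \<longlongrightarrow> grad f y \<bullet> (x - y)) (at_right 0)"
    by (auto simp: DERIV_def intro: tendsto_within_subset)
  moreover have "\<forall>\<^sub>F h in at_right 0. (f (y + h *\<^sub>R (x - y)) - f y) / h \<le> f x - f y"
    using eventually_at_right_real[OF zero_less_one]
  proof eventually_elim
    fix h :: real assume h: "h \<in> {0<..<1}"
    have "f ((1 - h) *\<^sub>R y + h *\<^sub>R x) \<le> (1 - h) * f y + h * f x"
      using h by (intro convex_onD[OF conv]) auto
    moreover have "(1 - h) *\<^sub>R y + h *\<^sub>R x = y + h *\<^sub>R (x - y)"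
      by (simp add: algebra_simps)
    ultimately have "f (y + h *\<^sub>R (x - y)) - f y \<le> (f x - f y) * h"
      by (simp add: algebra_simps)
    then show "(f (y + h *\<^sub>R (x - y)) - f y) / h \<le> f x - f y"
      using h by (subst pos_divide_le_eq) auto
  qed
  ultimately have "grad f y \<bullet> (x - y) \<le> f x - f y"
    by (rule tendsto_upperbound) simp
  then show ?thesis by simp
qed

lemma gradient_step_le:
  fixes f :: "'a::euclidean_space \<Rightarrow> real"
  assumes "L_smooth L f" "L > 0"
  shows "f (y - (1 / L) *\<^sub>R grad f y) \<le> f y - (norm (grad f y))\<^sup>2 / (2 * L)"
proof -
  have "f (y - (1 / L) *\<^sub>R grad f y) \<le> f y + grad f y \<bullet> ((y - (1 / L) *\<^sub>R grad f y) - y)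
      + L / 2 * (norm ((y - (1 / L) *\<^sub>R grad f y) - y))\<^sup>2"
    using assms unfolding L_smooth_def by blast
  also have "\<dots> = f y - (norm (grad f y))\<^sup>2 / (2 * L)"
    using assms(2) by (simp add: power_mult_distrib power2_norm_eq_inner[symmetric] field_simps power2_eq_square)
  finally show ?thesis .
qed

lemma norm_diff_scaleR_sq:
  fixes v g :: "'a::real_inner"
  shows "(norm (v - c *\<^sub>R g))\<^sup>2 = (norm v)\<^sup>2 - 2 * c * (g \<bullet> v) + c\<^sup>2 * (norm g)\<^sup>2"
  unfolding power2_norm_eq_inner
  by (simp add: inner_diff_left inner_diff_right inner_commute algebra_simps power2_eq_square)

lemma has_real_derivative_norm_sq:
  fixes v :: "real \<Rightarrow> 'a::real_inner"
  assumes "(v has_vector_derivative v') (at u)"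
  shows "((\<lambda>u. (norm (v u))\<^sup>2) has_real_derivative 2 * (v u \<bullet> v')) (at u)"
proof -
  have "((\<lambda>u. v u \<bullet> v u) has_derivative (\<lambda>h. v u \<bullet> (h *\<^sub>R v') + (h *\<^sub>R v') \<bullet> v u)) (at u)"
    using assms unfolding has_vector_derivative_def by (intro has_derivative_inner)
  then show ?thesis
    unfolding power2_norm_eq_inner
    by (rule has_derivative_imp_has_field_derivative) (simp add: inner_commute)
qed

text \<open>Between two jumps both components move along the fixed direction \<open>z - x\<close>,
  so differentiating a path reduces to differentiating its scalar coefficient.\<close>

lemma has_vector_derivative_ray:
  fixes p v :: "'a::real_normed_vector"
  assumes "(\<tau> has_real_derivative \<tau>') (at u)"
  shows "((\<lambda>u. p + \<tau> u *\<^sub>R v) has_vector_derivative \<tau>' *\<^sub>R v) (at u)"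
  using assms unfolding has_vector_derivative_def has_field_derivative_def
  by (auto intro!: derivative_eq_intros simp: algebra_simps)

section \<open>The jump chain and its two Lyapunov functions\<close>

type_synonym 'a nesterov_state = "real \<times> 'a \<times> 'a"

text \<open>The time of the last jump belongs to the state because the coefficients may depend on
  absolute time; with it the chain is time homogeneous and driven by the waiting times
  alone.\<close>

definition nesterov_step ::
  "('a::euclidean_space \<Rightarrow> real) \<Rightarrow> (real \<Rightarrow> real \<Rightarrow> real) \<Rightarrow> (real \<Rightarrow> real \<Rightarrow> real) \<Rightarrow> (real \<Rightarrow> real) \<Rightarrow> (real \<Rightarrow> real)
    \<Rightarrow> 'a nesterov_state \<Rightarrow> real \<Rightarrow> 'a nesterov_state" where
  "nesterov_step f \<tau> \<tau>' \<gamma> \<gamma>' = (\<lambda>(s, x, z) \<delta>.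
     let t = s + \<delta>; y = x + \<tau> s t *\<^sub>R (z - x)
     in (t, y - \<gamma> t *\<^sub>R grad f y, z + \<tau>' s t *\<^sub>R (y - z) - \<gamma>' t *\<^sub>R grad f y))"

lemma measurable_nesterov_step:
  fixes f :: "'a::euclidean_space \<Rightarrow> real"
  assumes f: "\<And>p. f differentiable (at p)"
    and \<tau>: "case_prod \<tau> \<in> borel_measurable (borel \<Otimes>\<^sub>M borel)"
    and \<tau>': "case_prod \<tau>' \<in> borel_measurable (borel \<Otimes>\<^sub>M borel)"
    and [measurable]: "\<gamma> \<in> borel_measurable borel" "\<gamma>' \<in> borel_measurable borel"
  shows "case_prod (nesterov_step f \<tau> \<tau>' \<gamma> \<gamma>')
    \<in> (borel \<Otimes>\<^sub>M borel \<Otimes>\<^sub>M borel) \<Otimes>\<^sub>M borel \<rightarrow>\<^sub>M borel \<Otimes>\<^sub>M borel \<Otimes>\<^sub>M borel"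
proof -
  note [measurable] = borel_measurable_grad[OF f]
  have [measurable]: "(\<lambda>x. \<tau> (p x) (q x)) \<in> borel_measurable M" "(\<lambda>x. \<tau>' (p x) (q x)) \<in> borel_measurable M"
    if [measurable]: "p \<in> borel_measurable M" "q \<in> borel_measurable M" for p q and M :: "'m measure"
    using measurable_compose[OF measurable_Pair[OF that] \<tau>] measurable_compose[OF measurable_Pair[OF that] \<tau>']
    by simp_all
  show ?thesis
    unfolding nesterov_step_def Let_def case_prod_beta' by measurable
qed

text \<open>The factor \<open>2 * L\<close> is fitted to the jump of \<open>z\<close> by
  \<open>s / (2 * L)\<close> times the gradient \<open>g\<close>: expanding the square produces the
  cross term \<open>- 2 * s * (g \<bullet> (z - xs))\<close>, matched by the derivative of the
  weight \<open>s\<^sup>2\<close>, and the term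
  \<open>s\<^sup>2 * (norm g)\<^sup>2 / (2 * L)\<close>, which is the decrease guaranteed by the
  weighted gradient step.\<close>

definition lyapunov_convex :: "('a::euclidean_space \<Rightarrow> real) \<Rightarrow> real \<Rightarrow> 'a \<Rightarrow> 'a nesterov_state \<Rightarrow> real" where
  "lyapunov_convex f L xs = (\<lambda>(s, x, z). s\<^sup>2 * (f x - f xs) + 2 * L * (norm (z - xs))\<^sup>2)"

lemma lyapunov_convex_step:
  fixes f :: "'a::euclidean_space \<Rightarrow> real"
  assumes conv: "convex_on UNIV f" and f: "\<And>p. f differentiable (at p)" and L: "L > 0" "L_smooth L f"
    and min: "\<And>y. f xs \<le> f y" and s: "0 \<le> s"
  shows "(\<integral>\<^sup>+\<delta>. ennreal (exponential_density 1 \<delta>) * ennreal (lyapunov_convex f L xs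
      (nesterov_step f (\<lambda>s t. 1 - (s / t)\<^sup>2) (\<lambda>_ _. 0) (\<lambda>_. 1 / L) (\<lambda>t. t / (2 * L)) (s, x, z) \<delta>)) \<partial>lborel)
    \<le> ennreal (lyapunov_convex f L xs (s, x, z))"
proof -
  define y where "y u = x + (1 - (s / u)\<^sup>2) *\<^sub>R (z - x)" for u
  define \<psi> where "\<psi> u = u\<^sup>2 * (f (y u) - f xs) + 2 * L * (norm (z - xs))\<^sup>2" for u
  define \<psi>' where "\<psi>' u = 2 * u * (f (y u) - f xs) + 2 * u * (grad f (y u) \<bullet> (z - y u))" for u
  define q where "q u = u\<^sup>2 * (f (y u - (1 / L) *\<^sub>R grad f (y u)) - f xs)
      + 2 * L * (norm (z - (u / (2 * L)) *\<^sub>R grad f (y u) - xs))\<^sup>2" for u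
  have zy: "z - y u = (s / u)\<^sup>2 *\<^sub>R (z - x)" for u
    by (simp add: y_def algebra_simps)
  have deriv: "(\<psi> has_real_derivative \<psi>' u) (at u)" if u: "s \<le> u" for u
  proof -
    \<comment> \<open>The flow equation for \<open>y\<close>, with rate \<open>2 / u\<close>, is
      multiplied by \<open>u\<^sup>2\<close> so that it makes sense at \<open>u = 0\<close>. That
      point occurs only for \<open>s = 0\<close>, where \<open>y\<close> is constantly
      \<open>z\<close>.\<close>
    have y': "\<exists>y'. (y has_vector_derivative y') (at u) \<and> u\<^sup>2 *\<^sub>R y' = (2 * u) *\<^sub>R (z - y u)"
    proof (cases "s = 0")
      case True
      then have "y = (\<lambda>_. z)" by (auto simp: y_def)
      then show ?thesis by (intro exI[of _ 0]) simp
    next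
      case False
      then have "0 < u" using u s by simp
      then have "((\<lambda>u. 1 - (s / u)\<^sup>2) has_real_derivative 2 * s\<^sup>2 / u ^ 3) (at u)"
        by (auto intro!: derivative_eq_intros simp: field_simps power2_eq_square power3_eq_cube)
      then have "(y has_vector_derivative (2 * s\<^sup>2 / u ^ 3) *\<^sub>R (z - x)) (at u)"
        unfolding y_def[abs_def] by (rule has_vector_derivative_ray)
      moreover have "u\<^sup>2 *\<^sub>R ((2 * s\<^sup>2 / u ^ 3) *\<^sub>R (z - x)) = (2 * u) *\<^sub>R (z - y u)"
        using \<open>0 < u\<close> by (simp add: zy power_divide field_simps power2_eq_square power3_eq_cube)
      ultimately show ?thesis by blast
    qed
    then obtain y' where y': "(y has_vector_derivative y') (at u)" "u\<^sup>2 *\<^sub>R y' = (2 * u) *\<^sub>R (z - y u)"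
      by blast
    have "(\<psi> has_real_derivative 2 * u * (f (y u) - f xs) + u\<^sup>2 * (grad f (y u) \<bullet> y')) (at u)"
      unfolding \<psi>_def[abs_def]
      by (auto intro!: derivative_eq_intros has_real_derivative_along[OF f y'(1)] simp: algebra_simps)
    moreover have "u\<^sup>2 * (grad f (y u) \<bullet> y') = 2 * u * (grad f (y u) \<bullet> (z - y u))"
      using arg_cong[OF y'(2), of "\<lambda>v. grad f (y u) \<bullet> v"] by (simp add: inner_scaleR_right)
    ultimately show ?thesis by (simp add: \<psi>'_def)
  qed
  \<comment> \<open>The squared gradients cancel. The flow term with \<open>z - y u\<close> and the
    cross term with \<open>z - xs\<close> leave \<open>2 * u\<close> times the inner product of the
    gradient with \<open>xs - y u\<close>; by convexity this compensates
    \<open>2 * u * (f (y u) - f xs)\<close>, the derivative of the weight times the gap in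
    value.\<close>
  have drift: "\<psi>' u + q u \<le> \<psi> u" if "s \<le> u" for u
  proof -
    let ?g = "grad f (y u)"
    have u: "0 \<le> u" using s that by simp
    have "z - (u / (2 * L)) *\<^sub>R ?g - xs = (z - xs) - (u / (2 * L)) *\<^sub>R ?g" by simp
    then have "2 * L * (norm (z - (u / (2 * L)) *\<^sub>R ?g - xs))\<^sup>2
        = 2 * L * (norm (z - xs))\<^sup>2 - 2 * u * (?g \<bullet> (z - xs)) + u\<^sup>2 * ((norm ?g)\<^sup>2 / (2 * L))"
      using L(1) by (simp only: norm_diff_scaleR_sq) (simp add: field_simps power2_eq_square)
    moreover have "u\<^sup>2 * f (y u - (1 / L) *\<^sub>R ?g) \<le> u\<^sup>2 * (f (y u) - (norm ?g)\<^sup>2 / (2 * L))"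
      by (intro mult_left_mono gradient_step_le L) simp
    moreover have "2 * u * (f (y u) + ?g \<bullet> (xs - y u)) \<le> 2 * u * f xs"
      using u by (intro mult_left_mono convex_grad_le conv f) auto
    ultimately show ?thesis
      unfolding \<psi>_def \<psi>'_def q_def by (simp add: algebra_simps inner_diff_right)
  qed
  have cont: "continuous_on UNIV f"
    using f by (simp add: continuous_on_eq_continuous_at differentiable_imp_continuous_within)
  note [measurable] = borel_measurable_continuous_onI[OF cont] borel_measurable_grad[OF f]
  have [measurable]: "y \<in> borel_measurable borel" unfolding y_def[abs_def] by measurable
  have nonneg: "0 \<le> \<psi> u" "0 \<le> q u" for u
    using min L by (auto simp: \<psi>_def q_def)
  have "(\<integral>\<^sup>+\<delta>. ennreal (exponential_density 1 \<delta>) * ennreal (q (s + \<delta>)) \<partial>lborel) \<le> ennreal (\<psi> s)"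
    using deriv nonneg drift
    by (rule nn_integral_exponential_le) (unfold \<psi>_def[abs_def] \<psi>'_def[abs_def], measurable)
  moreover have "lyapunov_convex f L xs
      (nesterov_step f (\<lambda>s t. 1 - (s / t)\<^sup>2) (\<lambda>_ _. 0) (\<lambda>_. 1 / L) (\<lambda>t. t / (2 * L)) (s, x, z) \<delta>) = q (s + \<delta>)" for \<delta>
    by (simp add: lyapunov_convex_def nesterov_step_def Let_def q_def y_def)
  \<comment> \<open>For \<open>s = 0\<close> the curve \<open>y\<close> starts at \<open>z\<close>
    and not at \<open>x\<close>, but then the weight \<open>s\<^sup>2\<close> removes the value of
    \<open>f\<close>.\<close>
  moreover have "\<psi> s = lyapunov_convex f L xs (s, x, z)"
    by (cases "s = 0") (auto simp: \<psi>_def lyapunov_convex_def y_def)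
  ultimately show ?thesis by simp
qed

definition lyapunov_strong :: "('a::euclidean_space \<Rightarrow> real) \<Rightarrow> real \<Rightarrow> real \<Rightarrow> 'a \<Rightarrow> 'a nesterov_state \<Rightarrow> real" where
  "lyapunov_strong f c \<mu> xs = (\<lambda>(s, x, z). exp (c * s) * (f x - f xs + \<mu> / 2 * (norm (z - xs))\<^sup>2))"

lemma lyapunov_strong_step:
  fixes f :: "'a::euclidean_space \<Rightarrow> real"
  assumes strong: "strongly_convex \<mu> f" and f: "\<And>p. f differentiable (at p)"
    and L: "L > 0" "L_smooth L f" and \<mu>: "\<mu> > 0" and min: "\<And>y. f xs \<le> f y"
    and c_def: "c = sqrt (\<mu> / L)"
  shows "(\<integral>\<^sup>+\<delta>. ennreal (exponential_density 1 \<delta>) * ennreal (lyapunov_strong f c \<mu> xs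
      (nesterov_step f (\<lambda>s t. 1 / 2 * (1 - exp (- 2 * c * (t - s)))) (\<lambda>s t. tanh (c * (t - s)))
        (\<lambda>_. 1 / L) (\<lambda>_. 1 / sqrt (\<mu> * L)) (s, x, z) \<delta>)) \<partial>lborel)
    \<le> ennreal (lyapunov_strong f c \<mu> xs (s, x, z))"
proof -
  define \<tau> where "\<tau> u = 1 / 2 * (1 - exp (- 2 * c * (u - s)))" for u
  define y where "y u = x + \<tau> u *\<^sub>R (z - x)" for u
  \<comment> \<open>\<open>w\<close> is the second component along the flow: equal rates conserve
    the sum of the two components, so it moves opposite to \<open>y\<close>.\<close>
  define w where "w u = z - \<tau> u *\<^sub>R (z - x)" for u
  define \<gamma> where "\<gamma> = 1 / sqrt (\<mu> * L)"
  define \<psi> where "\<psi> u = exp (c * u) * (f (y u) - f xs + \<mu> / 2 * (norm (w u - xs))\<^sup>2)" for u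
  define d where "d u = c * (f (y u) - f xs + \<mu> / 2 * (norm (w u - xs))\<^sup>2)
      + c * (grad f (y u) \<bullet> (w u - y u)) + \<mu> * c * ((w u - xs) \<bullet> (y u - w u))" for u
  define q where "q u = exp (c * u) * (f (y u - (1 / L) *\<^sub>R grad f (y u)) - f xs
      + \<mu> / 2 * (norm (w u - \<gamma> *\<^sub>R grad f (y u) - xs))\<^sup>2)" for u
  have c: "c > 0" using \<mu> L by (auto simp: c_def)
  \<comment> \<open>The first identity lets the cross term of the jump combine with the flow term
    into \<open>c\<close> times the inner product of the gradient with \<open>xs - y u\<close>; the
    second equates the squared gradient produced by the jump of \<open>z\<close> with the gain of
    the gradient step.\<close>
  have \<gamma>: "\<mu> * \<gamma> = c" "\<mu> * \<gamma>\<^sup>2 = 1 / L"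
  proof -
    show "\<mu> * \<gamma>\<^sup>2 = 1 / L" using \<mu> L by (simp add: \<gamma>_def power_divide)
    have "\<mu> * \<gamma> = \<mu> / sqrt \<mu> / sqrt L" by (simp add: \<gamma>_def real_sqrt_mult)
    also have "\<dots> = c" using \<mu> by (simp add: c_def real_div_sqrt real_sqrt_divide)
    finally show "\<mu> * \<gamma> = c" .
  qed
  have gap: "w u - y u = exp (- 2 * c * (u - s)) *\<^sub>R (z - x)" for u
  proof -
    have "w u - y u = (1 - 2 * \<tau> u) *\<^sub>R (z - x)"
      by (simp add: w_def y_def algebra_simps flip: scaleR_add_left)
    also have "1 - 2 * \<tau> u = exp (- 2 * c * (u - s))" unfolding \<tau>_def by argo
    finally show ?thesis .
  qed
  have \<tau>': "(\<tau> has_real_derivative c * exp (- 2 * c * (u - s))) (at u)" for u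
    unfolding \<tau>_def[abs_def] by (auto intro!: derivative_eq_intros)
  have y': "(y has_vector_derivative c *\<^sub>R (w u - y u)) (at u)"
    and w': "((\<lambda>u. w u - xs) has_vector_derivative c *\<^sub>R (y u - w u)) (at u)" for u
  proof -
    have eqs: "c *\<^sub>R (w u - y u) = (c * exp (- 2 * c * (u - s))) *\<^sub>R (z - x)"
        "c *\<^sub>R (y u - w u) = (c * exp (- 2 * c * (u - s))) *\<^sub>R - (z - x)"
      using gap[of u] minus_diff_eq[of "w u" "y u"] by (simp_all only: scaleR_scaleR scaleR_minus_right flip: minus_diff_eq[of "w u" "y u"])
    show "(y has_vector_derivative c *\<^sub>R (w u - y u)) (at u)"
      unfolding eqs unfolding y_def[abs_def] by (rule has_vector_derivative_ray[OF \<tau>'])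
    have "(\<lambda>u. w u - xs) = (\<lambda>u. (z - xs) + \<tau> u *\<^sub>R - (z - x))"
      by (simp only: w_def scaleR_minus_right diff_conv_add_uminus ac_simps)
    then show "((\<lambda>u. w u - xs) has_vector_derivative c *\<^sub>R (y u - w u)) (at u)"
      unfolding eqs by (simp only: has_vector_derivative_ray[OF \<tau>'])
  qed
  have deriv: "(\<psi> has_real_derivative exp (c * u) * d u) (at u)" for u
  proof -
    have e: "((\<lambda>u. exp (c * u)) has_real_derivative c * exp (c * u)) (at u)"
      by (auto intro!: derivative_eq_intros)
    have "((\<lambda>u. f (y u) - f xs + \<mu> / 2 * (norm (w u - xs))\<^sup>2) has_real_derivative
        grad f (y u) \<bullet> (c *\<^sub>R (w u - y u)) - 0 + \<mu> / 2 * (2 * ((w u - xs) \<bullet> (c *\<^sub>R (y u - w u))))) (at u)"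
      by (intro DERIV_add DERIV_diff DERIV_const DERIV_cmult has_real_derivative_along[OF f y']
          has_real_derivative_norm_sq[OF w'])
    from DERIV_mult[OF e this] show ?thesis
      unfolding \<psi>_def[abs_def] by (rule DERIV_cong) (simp add: d_def distrib_left mult_ac)
  qed
  have drift: "exp (c * u) * d u + q u \<le> \<psi> u" for u
  proof -
    let ?g = "grad f (y u)"
    have "w u - \<gamma> *\<^sub>R ?g - xs = (w u - xs) - \<gamma> *\<^sub>R ?g" by simp
    then have "\<mu> / 2 * (norm (w u - \<gamma> *\<^sub>R ?g - xs))\<^sup>2
        = \<mu> / 2 * (norm (w u - xs))\<^sup>2 - (\<mu> * \<gamma>) * (?g \<bullet> (w u - xs)) + (\<mu> * \<gamma>\<^sup>2) * (norm ?g)\<^sup>2 / 2"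
      by (simp only: norm_diff_scaleR_sq) (simp add: field_simps)
    also have "\<dots> = \<mu> / 2 * (norm (w u - xs))\<^sup>2 - c * (?g \<bullet> (w u - xs)) + (norm ?g)\<^sup>2 / (2 * L)"
      unfolding \<gamma> by simp
    finally have 1: "\<mu> / 2 * (norm (w u - \<gamma> *\<^sub>R ?g - xs))\<^sup>2 = \<dots>" .
    have 2: "f (y u - (1 / L) *\<^sub>R ?g) \<le> f (y u) - (norm ?g)\<^sup>2 / (2 * L)"
      by (intro gradient_step_le L)
    have "f (y u) + ?g \<bullet> (xs - y u) + \<mu> / 2 * (norm (xs - y u))\<^sup>2 \<le> f xs"
      using strong by (simp add: strongly_convex_def)
    then have 3: "c * (f (y u) + ?g \<bullet> (xs - y u) + \<mu> / 2 * (norm (xs - y u))\<^sup>2) \<le> c * f xs"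
      using c by (intro mult_left_mono) auto
    \<comment> \<open>This splits the drift of \<open>w\<close> towards \<open>y\<close>: the first
      square is absorbed by strong convexity, the second cancels the part of the derivative of the
      exponential weight that multiplies the distance of \<open>w\<close> to \<open>xs\<close>, and
      the third has a favourable sign.\<close>
    have polar: "2 * ((w u - xs) \<bullet> (y u - w u)) = (norm (xs - y u))\<^sup>2 - (norm (w u - xs))\<^sup>2 - (norm (y u - w u))\<^sup>2"
      by (simp add: power2_norm_eq_inner inner_diff_left inner_diff_right inner_commute)
    have 4: "\<mu> * c * ((w u - xs) \<bullet> (y u - w u))
        \<le> c * (\<mu> / 2 * (norm (xs - y u))\<^sup>2) - c * (\<mu> / 2 * (norm (w u - xs))\<^sup>2)"
    proof -
      have "\<mu> * c * ((w u - xs) \<bullet> (y u - w u)) = \<mu> * c / 2 * (2 * ((w u - xs) \<bullet> (y u - w u)))" by simp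
      also have "\<dots> \<le> \<mu> * c / 2 * ((norm (xs - y u))\<^sup>2 - (norm (w u - xs))\<^sup>2)"
        unfolding polar using \<mu> c by (intro mult_left_mono) auto
      finally show ?thesis by (simp add: algebra_simps)
    qed
    have 5: "?g \<bullet> (w u - xs) = ?g \<bullet> (w u - y u) - ?g \<bullet> (xs - y u)"
      by (simp add: inner_diff_right)
    have "d u + (f (y u - (1 / L) *\<^sub>R ?g) - f xs + \<mu> / 2 * (norm (w u - \<gamma> *\<^sub>R ?g - xs))\<^sup>2)
        \<le> f (y u) - f xs + \<mu> / 2 * (norm (w u - xs))\<^sup>2"
      unfolding d_def 1 5 using 2 3 4 by (simp add: algebra_simps)
    from mult_left_mono[OF this, of "exp (c * u)"] show ?thesis
      by (simp add: q_def \<psi>_def distrib_left)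
  qed
  have cont: "continuous_on UNIV f"
    using f by (simp add: continuous_on_eq_continuous_at differentiable_imp_continuous_within)
  note [measurable] = borel_measurable_continuous_onI[OF cont] borel_measurable_grad[OF f]
  have [measurable]: "y \<in> borel_measurable borel" "w \<in> borel_measurable borel"
    unfolding y_def[abs_def] w_def[abs_def] \<tau>_def by measurable
  have nonneg: "0 \<le> \<psi> u" "0 \<le> q u" for u
    using min \<mu> by (auto simp: \<psi>_def q_def)
  have "(\<integral>\<^sup>+\<delta>. ennreal (exponential_density 1 \<delta>) * ennreal (q (s + \<delta>)) \<partial>lborel) \<le> ennreal (\<psi> s)"
    using deriv nonneg drift
    by (rule nn_integral_exponential_le) (unfold \<psi>_def[abs_def] d_def[abs_def], measurable)
  moreover have "lyapunov_strong f c \<mu> xs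
      (nesterov_step f (\<lambda>s t. 1 / 2 * (1 - exp (- 2 * c * (t - s)))) (\<lambda>s t. tanh (c * (t - s)))
        (\<lambda>_. 1 / L) (\<lambda>_. 1 / sqrt (\<mu> * L)) (s, x, z) \<delta>) = q (s + \<delta>)" for \<delta>
  proof -
    define E where "E = exp (- 2 * c * \<delta>)"
    have E: "0 < E" "tanh (c * \<delta>) = (1 - E) / (1 + E)"
      by (simp_all add: E_def tanh_real_altdef mult.assoc)
    have \<tau>: "\<tau> (s + \<delta>) = (1 - E) / 2" by (simp add: \<tau>_def E_def)
    \<comment> \<open>This reconciles two forms of the same move: the chain adds \<open>tanh\<close>
      times \<open>y - z\<close>, the flow adds \<open>- \<tau>\<close> times \<open>z - x\<close>,
      and \<open>y - z\<close> is \<open>\<tau> - 1\<close> times \<open>z - x\<close>.\<close>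
    have "(1 - E) / (1 + E) * ((1 - E) / 2 - 1) = - ((1 - E) / 2)"
      using E(1) by (simp add: divide_simps) (simp add: algebra_simps)
    then have "tanh (c * \<delta>) * (\<tau> (s + \<delta>) - 1) = - \<tau> (s + \<delta>)"
      by (simp only: E(2) \<tau>)
    moreover have "y (s + \<delta>) - z = (\<tau> (s + \<delta>) - 1) *\<^sub>R (z - x)"
      by (simp add: y_def algebra_simps)
    ultimately have "z + tanh (c * \<delta>) *\<^sub>R (y (s + \<delta>) - z) = w (s + \<delta>)"
      by (simp add: w_def)
    then show ?thesis
      by (simp add: lyapunov_strong_def nesterov_step_def Let_def q_def \<gamma>_def)
        (simp add: y_def \<tau>_def)
  qed
  moreover have "\<psi> s = lyapunov_strong f c \<mu> xs (s, x, z)"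
    by (simp add: \<psi>_def lyapunov_strong_def y_def w_def \<tau>_def)
  ultimately show ?thesis by simp
qed

section \<open>The continuized process\<close>

lemma poisson_times_facts:
  assumes "poisson_times M T"
  shows "prob_space M" "\<And>\<omega>. \<omega> \<in> space M \<Longrightarrow> T 0 \<omega> = 0"
    "\<And>\<omega> k. \<omega> \<in> space M \<Longrightarrow> T k \<omega> < T (Suc k) \<omega>" "\<And>\<omega> k. \<omega> \<in> space M \<Longrightarrow> 0 \<le> T k \<omega>"
    "\<And>k. T k \<in> borel_measurable M"
proof -
  show "prob_space M" and T0: "\<And>\<omega>. \<omega> \<in> space M \<Longrightarrow> T 0 \<omega> = 0"
    and T_less: "\<And>\<omega> k. \<omega> \<in> space M \<Longrightarrow> T k \<omega> < T (Suc k) \<omega>"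
    using assms by (auto simp: poisson_times_def strict_mono_Suc_iff)
  show "0 \<le> T k \<omega>" if "\<omega> \<in> space M" for \<omega> k
    using T0[OF that] T_less[OF that] by (induction k) (auto intro: order_trans less_imp_le)
  have D: "(\<lambda>\<omega>. T (Suc i) \<omega> - T i \<omega>) \<in> borel_measurable M" for i
    using assms by (auto simp: poisson_times_def dest!: spec[of _ i] dest: distributed_measurable)
  have sum: "T k \<omega> = (\<Sum>i<k. T (Suc i) \<omega> - T i \<omega>)" if "\<omega> \<in> space M" for k \<omega>
    using T0[OF that] sum_lessThan_telescope[of "\<lambda>k. T k \<omega>" k] by simp
  have "(\<lambda>\<omega>. \<Sum>i<k. T (Suc i) \<omega> - T i \<omega>) \<in> borel_measurable M" for k
    using D by (rule borel_measurable_sum)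
  then show "T k \<in> borel_measurable M" for k
    by (rule measurable_cong[THEN iffD2, rotated]) (rule sum)
qed

lemma left_lim_tendsto:
  assumes "cadlag p" "t > 0"
  shows "(p \<longlongrightarrow> left_lim p t) (at_left t)"
proof -
  obtain l where l: "(p \<longlongrightarrow> l) (at_left t)" using assms by (auto simp: cadlag_def)
  then have "left_lim p t = l" unfolding left_lim_def by (intro tendsto_Lim) auto
  with l show ?thesis by simp
qed

lemma continuized_step:
  fixes x z :: "real \<Rightarrow> 'w \<Rightarrow> 'a::euclidean_space"
  assumes T: "poisson_times M T" and rates: "mixing_rate \<eta>" "mixing_rate \<eta>'"
    and proc: "continuized_process M T f \<eta> \<eta>' \<gamma> \<gamma>' x0 z0 x z"
  defines "yt \<equiv> \<lambda>k \<omega>. left_lim (\<lambda>t. x t \<omega>) (T (Suc k) \<omega>)"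
    and "\<tau> \<equiv> \<lambda>k \<omega>. mix_coeff \<eta> \<eta>' (T k \<omega>) (T (Suc k) \<omega>)"
    and "\<tau>' \<equiv> \<lambda>k \<omega>. mix_coeff' \<eta> \<eta>' (T k \<omega>) (T (Suc k) \<omega>)"
  shows "AE \<omega> in M. x 0 \<omega> = x0 \<and> z 0 \<omega> = z0 \<and> (\<forall>k.
      yt k \<omega> = x (T k \<omega>) \<omega> + \<tau> k \<omega> *\<^sub>R (z (T k \<omega>) \<omega> - x (T k \<omega>) \<omega>) \<and>
      x (T (Suc k) \<omega>) \<omega> = yt k \<omega> - \<gamma> (T (Suc k) \<omega>) *\<^sub>R grad f (yt k \<omega>) \<and>
      ((\<forall>t>0. \<eta>' t \<ge> 0) \<or> \<tau> k \<omega> \<noteq> 1 \<longrightarrow>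
        z (T (Suc k) \<omega>) \<omega> = z (T k \<omega>) \<omega> + \<tau>' k \<omega> *\<^sub>R (yt k \<omega> - z (T k \<omega>) \<omega>)
          - \<gamma>' (T (Suc k) \<omega>) *\<^sub>R grad f (yt k \<omega>)))"
proof -
  note Tf = poisson_times_facts[OF T]
  have "AE \<omega> in M. x 0 \<omega> = x0 \<and> z 0 \<omega> = z0 \<and>
      continuized_path f \<eta> \<eta>' \<gamma> \<gamma>' (\<lambda>k. T k \<omega>) (\<lambda>t. x t \<omega>) (\<lambda>t. z t \<omega>)"
    using proc by (simp add: continuized_process_def)
  with AE_space show ?thesis
  proof eventually_elim
    case (elim \<omega>)
    then have path: "continuized_path f \<eta> \<eta>' \<gamma> \<gamma>' (\<lambda>k. T k \<omega>) (\<lambda>t. x t \<omega>) (\<lambda>t. z t \<omega>)" by simp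
    have cad: "cadlag (\<lambda>t. x t \<omega>)" "cadlag (\<lambda>t. z t \<omega>)"
      using proc elim(1) by (auto simp: continuized_process_def)
    have "yt k \<omega> = x (T k \<omega>) \<omega> + \<tau> k \<omega> *\<^sub>R (z (T k \<omega>) \<omega> - x (T k \<omega>) \<omega>) \<and>
      x (T (Suc k) \<omega>) \<omega> = yt k \<omega> - \<gamma> (T (Suc k) \<omega>) *\<^sub>R grad f (yt k \<omega>) \<and>
      ((\<forall>t>0. \<eta>' t \<ge> 0) \<or> \<tau> k \<omega> \<noteq> 1 \<longrightarrow>
        z (T (Suc k) \<omega>) \<omega> = z (T k \<omega>) \<omega> + \<tau>' k \<omega> *\<^sub>R (yt k \<omega> - z (T k \<omega>) \<omega>)
          - \<gamma>' (T (Suc k) \<omega>) *\<^sub>R grad f (yt k \<omega>))" for k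
    proof -
      let ?zl = "left_lim (\<lambda>t. z t \<omega>) (T (Suc k) \<omega>)"
      have ab: "0 \<le> T k \<omega>" "T k \<omega> < T (Suc k) \<omega>" "0 < T (Suc k) \<omega>"
        using Tf(3)[OF elim(1), of k] Tf(4)[OF elim(1), of k] by auto
      have flow: "solves_flow \<eta> (\<lambda>t. x t \<omega>) (\<lambda>t. z t \<omega>) (T k \<omega>) (T (Suc k) \<omega>)"
        "solves_flow \<eta>' (\<lambda>t. z t \<omega>) (\<lambda>t. x t \<omega>) (T k \<omega>) (T (Suc k) \<omega>)"
        and jump: "x (T (Suc k) \<omega>) \<omega> = yt k \<omega> - \<gamma> (T (Suc k) \<omega>) *\<^sub>R grad f (yt k \<omega>)"
        "z (T (Suc k) \<omega>) \<omega> = ?zl - \<gamma>' (T (Suc k) \<omega>) *\<^sub>R grad f (yt k \<omega>)"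
        using path by (auto simp: continuized_path_def yt_def)
      have rc: "continuous (at_right (T k \<omega>)) (\<lambda>t. x t \<omega>)" "continuous (at_right (T k \<omega>)) (\<lambda>t. z t \<omega>)"
        using cad ab by (auto simp: cadlag_def)
      note between = flow_between_jumps[OF flow rates ab(1,2) rc left_lim_tendsto[OF cad(1) ab(3)]
          left_lim_tendsto[OF cad(2) ab(3)]]
      have "yt k \<omega> = x (T k \<omega>) \<omega> + \<tau> k \<omega> *\<^sub>R (z (T k \<omega>) \<omega> - x (T k \<omega>) \<omega>)"
        using between(1) by (simp add: yt_def \<tau>_def)
      moreover have "?zl = z (T k \<omega>) \<omega> + \<tau>' k \<omega> *\<^sub>R (yt k \<omega> - z (T k \<omega>) \<omega>)"
        if "(\<forall>t>0. \<eta>' t \<ge> 0) \<or> \<tau> k \<omega> \<noteq> 1"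
        using between(2) that unfolding yt_def \<tau>_def \<tau>'_def by blast
      ultimately show ?thesis using jump by auto
    qed
    with elim show ?case by blast
  qed
qed

text \<open>By \<open>evol\<close> the states at the jump times almost surely form the chain driven
  by the waiting times, so the expectation can be computed for that chain, whose measurability comes
  from its construction.\<close>

lemma nn_integral_lyapunov_le:
  fixes x z :: "real \<Rightarrow> 'w \<Rightarrow> 'a::euclidean_space"
  assumes T: "poisson_times M T" and f: "\<And>p. f differentiable (at p)"
    and meas: "case_prod \<tau> \<in> borel_measurable (borel \<Otimes>\<^sub>M borel)" "case_prod \<tau>' \<in> borel_measurable (borel \<Otimes>\<^sub>M borel)"
      "\<gamma> \<in> borel_measurable borel" "\<gamma>' \<in> borel_measurable borel"
    and \<Phi>: "\<Phi> \<in> borel_measurable (borel \<Otimes>\<^sub>M borel \<Otimes>\<^sub>M borel)"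
    and evol: "AE \<omega> in M. x 0 \<omega> = x0 \<and> z 0 \<omega> = z0 \<and> (\<forall>k.
      (T (Suc k) \<omega>, x (T (Suc k) \<omega>) \<omega>, z (T (Suc k) \<omega>) \<omega>)
        = nesterov_step f \<tau> \<tau>' \<gamma> \<gamma>' (T k \<omega>, x (T k \<omega>) \<omega>, z (T k \<omega>) \<omega>) (T (Suc k) \<omega> - T k \<omega>))"
    and step: "\<And>s x z. 0 \<le> s \<Longrightarrow> (\<integral>\<^sup>+\<delta>. ennreal (exponential_density 1 \<delta>)
        * ennreal (\<Phi> (nesterov_step f \<tau> \<tau>' \<gamma> \<gamma>' (s, x, z) \<delta>)) \<partial>lborel) \<le> ennreal (\<Phi> (s, x, z))"
  shows "(\<integral>\<^sup>+\<omega>. ennreal (\<Phi> (T k \<omega>, x (T k \<omega>) \<omega>, z (T k \<omega>) \<omega>)) \<partial>M) \<le> ennreal (\<Phi> (0, x0, z0))"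
proof -
  note Tf = poisson_times_facts[OF T]
  interpret prob_space M by (rule Tf(1))
  define D where "D i \<omega> = T (Suc i) \<omega> - T i \<omega>" for i \<omega>
  define F where "F = nesterov_step f \<tau> \<tau>' \<gamma> \<gamma>'"
  let ?chain = "\<lambda>k \<omega>. driven_chain F (0, x0, z0) k (\<lambda>i. D i \<omega>)"
  \<comment> \<open>The time coordinate agrees at every point of the space, not just almost
    everywhere; the pathwise invariant of the chain is required in that form.\<close>
  have fst_chain: "fst (?chain k \<omega>) = T k \<omega>" if "\<omega> \<in> space M" for k \<omega>
    using Tf(2)[OF that] by (induction k) (auto simp: F_def nesterov_step_def Let_def D_def split: prod.splits)
  have state: "AE \<omega> in M. ?chain k \<omega> = (T k \<omega>, x (T k \<omega>) \<omega>, z (T k \<omega>) \<omega>)"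
    using evol AE_space
  proof eventually_elim
    case (elim \<omega>)
    show ?case
      by (induction k) (use elim Tf(2) in \<open>auto simp: F_def D_def\<close>)
  qed
  have "(\<integral>\<^sup>+\<omega>. ennreal (\<Phi> (?chain k \<omega>)) \<partial>M) \<le> ennreal (\<Phi> (0, x0, z0))"
  proof (rule nn_integral_driven_chain_le[where I = "{s. 0 \<le> fst s}" and N = "borel \<Otimes>\<^sub>M borel \<Otimes>\<^sub>M borel"])
    show "indep_vars (\<lambda>_. borel) D UNIV" "distributed M lborel (D k) (exponential_density 1)" for k
      using T by (auto simp: poisson_times_def D_def[abs_def])
    show "case_prod F \<in> (borel \<Otimes>\<^sub>M borel \<Otimes>\<^sub>M borel) \<Otimes>\<^sub>M borel \<rightarrow>\<^sub>M borel \<Otimes>\<^sub>M borel \<Otimes>\<^sub>M borel"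
      unfolding F_def using f meas by (rule measurable_nesterov_step)
    show "?chain k \<omega> \<in> {s. 0 \<le> fst s}" if "\<omega> \<in> space M" for k \<omega>
      using fst_chain[OF that] Tf(4)[OF that] by simp
    show "(\<integral>\<^sup>+\<delta>. ennreal (exponential_density 1 \<delta>) * ennreal (\<Phi> (F s \<delta>)) \<partial>lborel) \<le> ennreal (\<Phi> s)"
      if "s \<in> {s. 0 \<le> fst s}" for s
      using step[of "fst s" "fst (snd s)" "snd (snd s)"] that by (simp add: F_def)
  qed (use \<Phi> in \<open>auto simp: space_pair_measure\<close>)
  also have "(\<integral>\<^sup>+\<omega>. ennreal (\<Phi> (?chain k \<omega>)) \<partial>M)
      = (\<integral>\<^sup>+\<omega>. ennreal (\<Phi> (T k \<omega>, x (T k \<omega>) \<omega>, z (T k \<omega>) \<omega>)) \<partial>M)"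
    using state by (intro nn_integral_cong_AE) auto
  finally show ?thesis .
qed

text \<open>The integral of a nonintegrable function is 0 by convention, so a bound on it has
  content only together with integrability. Both follow by domination, here after discarding the
  distance term of the Lyapunov function.\<close>

lemma integral_le_of_nn_integral_le:
  fixes h :: "'w \<Rightarrow> real"
  assumes "h \<in> borel_measurable M" and "\<And>\<omega>. \<omega> \<in> space M \<Longrightarrow> 0 \<le> h \<omega>"
    and "\<And>\<omega>. \<omega> \<in> space M \<Longrightarrow> h \<omega> \<le> H \<omega>" and "(\<integral>\<^sup>+\<omega>. ennreal (H \<omega>) \<partial>M) \<le> ennreal r" and "0 \<le> r"
  shows "integrable M h" "(\<integral>\<omega>. h \<omega> \<partial>M) \<le> r"
proof -
  have le: "(\<integral>\<^sup>+\<omega>. ennreal (h \<omega>) \<partial>M) \<le> ennreal r"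
    using assms(3,4) by (intro order_trans[OF nn_integral_mono assms(4)]) (auto intro: ennreal_leI)
  then show "(\<integral>\<omega>. h \<omega> \<partial>M) \<le> r" using assms(5) by (intro integral_real_bounded)
  have "(\<integral>\<^sup>+\<omega>. ennreal (norm (h \<omega>)) \<partial>M) = (\<integral>\<^sup>+\<omega>. ennreal (h \<omega>) \<partial>M)"
    using assms(2) by (intro nn_integral_cong) auto
  also have "\<dots> < \<infinity>" using le by (auto intro: le_less_trans)
  finally show "integrable M h" using assms(1) by (intro integrableI_bounded) auto
qed

lemma continuized_value_measurable:
  fixes f :: "'a::euclidean_space \<Rightarrow> real"
  assumes T: "poisson_times M T" and f: "\<And>p. f differentiable (at p)"
    and proc: "continuized_process M T f \<eta> \<eta>' \<gamma> \<gamma>' x0 z0 x z"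
  shows "(\<lambda>\<omega>. f (x (T k \<omega>) \<omega>)) \<in> borel_measurable M"
proof -
  have "continuous_on UNIV f"
    using f by (simp add: continuous_on_eq_continuous_at differentiable_imp_continuous_within)
  then have "f \<in> borel_measurable borel" by (rule borel_measurable_continuous_onI)
  moreover have "(\<lambda>\<omega>. x (T k \<omega>) \<omega>) \<in> borel_measurable M"
  proof (rule borel_measurable_right_continuous_eval)
    show "x t \<in> borel_measurable M" if "0 \<le> t" for t
      using proc that by (simp add: continuized_process_def)
    show "continuous (at_right t) (\<lambda>t. x t \<omega>)" if "\<omega> \<in> space M" "0 \<le> t" for \<omega> t
      using proc that by (simp add: continuized_process_def cadlag_def)
  qed (use poisson_times_facts[OF T] in auto)
  ultimately show ?thesis by (rule measurable_compose[rotated])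
qed

lemma continuized_convex_rate:
  fixes f :: "'a::euclidean_space \<Rightarrow> real"
  assumes T: "poisson_times M T" and rates: "mixing_rate \<eta>" "mixing_rate \<eta>'"
    and proc: "continuized_process M T f \<eta> \<eta>' \<gamma> \<gamma>' x0 z0 x z"
    and conv: "convex_on UNIV f" and f: "\<And>p. f differentiable (at p)" and L: "L > 0" "L_smooth L f"
    and min: "\<And>y. f xs \<le> f y"
    and par: "\<forall>t>0. \<eta> t = 2 / t \<and> \<eta>' t = 0 \<and> \<gamma> t = 1 / L \<and> \<gamma>' t = t / (2 * L)"
  shows "\<And>k \<omega>. \<omega> \<in> space M \<Longrightarrow>
      mix_coeff \<eta> \<eta>' (T k \<omega>) (T (Suc k) \<omega>) = 1 - (T k \<omega> / T (Suc k) \<omega>)\<^sup>2 \<and>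
      mix_coeff' \<eta> \<eta>' (T k \<omega>) (T (Suc k) \<omega>) = 0 \<and>
      \<gamma> (T (Suc k) \<omega>) = 1 / L \<and> \<gamma>' (T (Suc k) \<omega>) = T (Suc k) \<omega> / (2 * L)"
    and "integrable M (\<lambda>\<omega>. (T k \<omega>)\<^sup>2 * (f (x (T k \<omega>) \<omega>) - f xs))"
    and "(\<integral>\<omega>. (T k \<omega>)\<^sup>2 * (f (x (T k \<omega>) \<omega>) - f xs) \<partial>M) \<le> 2 * L * (norm (z0 - xs))\<^sup>2"
proof -
  note Tf = poisson_times_facts[OF T]
  show coeff: "mix_coeff \<eta> \<eta>' (T k \<omega>) (T (Suc k) \<omega>) = 1 - (T k \<omega> / T (Suc k) \<omega>)\<^sup>2 \<and>
      mix_coeff' \<eta> \<eta>' (T k \<omega>) (T (Suc k) \<omega>) = 0 \<and>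
      \<gamma> (T (Suc k) \<omega>) = 1 / L \<and> \<gamma>' (T (Suc k) \<omega>) = T (Suc k) \<omega> / (2 * L)"
    if \<omega>: "\<omega> \<in> space M" for k \<omega>
  proof -
    have ab: "0 \<le> T k \<omega>" "T k \<omega> < T (Suc k) \<omega>" using Tf(3,4)[OF \<omega>] by auto
    have "mix_coeff \<eta> \<eta>' (T k \<omega>) (T (Suc k) \<omega>) = mix_coeff (\<lambda>u. 2 / u) (\<lambda>_. 0) (T k \<omega>) (T (Suc k) \<omega>)"
      "mix_coeff' \<eta> \<eta>' (T k \<omega>) (T (Suc k) \<omega>) = mix_coeff' (\<lambda>u. 2 / u) (\<lambda>_. 0) (T k \<omega>) (T (Suc k) \<omega>)"
      using rates par ab by (auto intro!: mix_coeff_cong simp: mixing_rate_def)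
    with mix_coeff_two_over[OF ab] par ab show ?thesis by auto
  qed
  note [measurable] = continuized_value_measurable[OF T f proc] Tf(5)
  let ?F = "nesterov_step f (\<lambda>s t. 1 - (s / t)\<^sup>2) (\<lambda>_ _. 0) (\<lambda>_. 1 / L) (\<lambda>t. t / (2 * L))"
  have evol: "AE \<omega> in M. x 0 \<omega> = x0 \<and> z 0 \<omega> = z0 \<and> (\<forall>k.
      (T (Suc k) \<omega>, x (T (Suc k) \<omega>) \<omega>, z (T (Suc k) \<omega>) \<omega>)
        = ?F (T k \<omega>, x (T k \<omega>) \<omega>, z (T k \<omega>) \<omega>) (T (Suc k) \<omega> - T k \<omega>))"
    using continuized_step[OF T rates proc] AE_space
  proof eventually_elim
    case (elim \<omega>)
    then show ?case using coeff[OF elim(2)] par by (auto simp: nesterov_step_def Let_def)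
  qed
  have "continuous_on UNIV f"
    using f by (simp add: continuous_on_eq_continuous_at differentiable_imp_continuous_within)
  then have [measurable]: "f \<in> borel_measurable borel" by (rule borel_measurable_continuous_onI)
  have \<Phi>: "lyapunov_convex f L xs \<in> borel_measurable (borel \<Otimes>\<^sub>M borel \<Otimes>\<^sub>M borel)"
    unfolding lyapunov_convex_def case_prod_beta' by measurable
  have "(\<integral>\<^sup>+\<omega>. ennreal (lyapunov_convex f L xs (T k \<omega>, x (T k \<omega>) \<omega>, z (T k \<omega>) \<omega>)) \<partial>M)
      \<le> ennreal (lyapunov_convex f L xs (0, x0, z0))"
  proof (rule nn_integral_lyapunov_le[where \<tau> = "\<lambda>s t. 1 - (s / t)\<^sup>2" and \<tau>' = "\<lambda>_ _. 0"
        and \<gamma> = "\<lambda>_. 1 / L" and \<gamma>' = "\<lambda>t. t / (2 * L)", OF T f _ _ _ _ \<Phi> evol])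
    show "(\<lambda>(s, t). 1 - (s / t)\<^sup>2) \<in> borel_measurable (borel \<Otimes>\<^sub>M (borel :: real measure))"
      unfolding case_prod_beta' by measurable
  qed (simp_all add: lyapunov_convex_step[OF conv f L min])
  then have *: "(\<integral>\<^sup>+\<omega>. ennreal (lyapunov_convex f L xs (T k \<omega>, x (T k \<omega>) \<omega>, z (T k \<omega>) \<omega>)) \<partial>M)
      \<le> ennreal (2 * L * (norm (z0 - xs))\<^sup>2)"
    by (simp add: lyapunov_convex_def)
  show "integrable M (\<lambda>\<omega>. (T k \<omega>)\<^sup>2 * (f (x (T k \<omega>) \<omega>) - f xs))"
    "(\<integral>\<omega>. (T k \<omega>)\<^sup>2 * (f (x (T k \<omega>) \<omega>) - f xs) \<partial>M) \<le> 2 * L * (norm (z0 - xs))\<^sup>2"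
    by (rule integral_le_of_nn_integral_le[OF _ _ _ *]; use min L in \<open>simp add: lyapunov_convex_def\<close>)+
qed

lemma continuized_strongly_convex_rate:
  fixes f :: "'a::euclidean_space \<Rightarrow> real"
  assumes T: "poisson_times M T" and rates: "mixing_rate \<eta>" "mixing_rate \<eta>'"
    and proc: "continuized_process M T f \<eta> \<eta>' \<gamma> \<gamma>' x0 z0 x z"
    and strong: "strongly_convex \<mu> f" and \<mu>: "\<mu> > 0"
    and f: "\<And>p. f differentiable (at p)" and L: "L > 0" "L_smooth L f" and min: "\<And>y. f xs \<le> f y"
    and par: "\<forall>t>0. \<eta> t = sqrt (\<mu> / L) \<and> \<eta>' t = sqrt (\<mu> / L) \<and> \<gamma> t = 1 / L \<and> \<gamma>' t = 1 / sqrt (\<mu> * L)"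
  shows "\<And>k \<omega>. \<omega> \<in> space M \<Longrightarrow>
      mix_coeff \<eta> \<eta>' (T k \<omega>) (T (Suc k) \<omega>) = 1 / 2 * (1 - exp (- 2 * sqrt (\<mu> / L) * (T (Suc k) \<omega> - T k \<omega>))) \<and>
      mix_coeff' \<eta> \<eta>' (T k \<omega>) (T (Suc k) \<omega>) = tanh (sqrt (\<mu> / L) * (T (Suc k) \<omega> - T k \<omega>)) \<and>
      \<gamma> (T (Suc k) \<omega>) = 1 / L \<and> \<gamma>' (T (Suc k) \<omega>) = 1 / sqrt (\<mu> * L)"
    and "integrable M (\<lambda>\<omega>. exp (sqrt (\<mu> / L) * T k \<omega>) * (f (x (T k \<omega>) \<omega>) - f xs))"
    and "(\<integral>\<omega>. exp (sqrt (\<mu> / L) * T k \<omega>) * (f (x (T k \<omega>) \<omega>) - f xs) \<partial>M)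
      \<le> f x0 - f xs + \<mu> / 2 * (norm (z0 - xs))\<^sup>2"
proof -
  note Tf = poisson_times_facts[OF T]
  define c where "c = sqrt (\<mu> / L)"
  have c: "c > 0" using \<mu> L by (simp add: c_def)
  have coeff: "mix_coeff \<eta> \<eta>' (T k \<omega>) (T (Suc k) \<omega>) = 1 / 2 * (1 - exp (- 2 * c * (T (Suc k) \<omega> - T k \<omega>))) \<and>
      mix_coeff' \<eta> \<eta>' (T k \<omega>) (T (Suc k) \<omega>) = tanh (c * (T (Suc k) \<omega> - T k \<omega>)) \<and>
      \<gamma> (T (Suc k) \<omega>) = 1 / L \<and> \<gamma>' (T (Suc k) \<omega>) = 1 / sqrt (\<mu> * L)"
    if \<omega>: "\<omega> \<in> space M" for k \<omega>
  proof -
    have ab: "0 \<le> T k \<omega>" "T k \<omega> < T (Suc k) \<omega>" using Tf(3,4)[OF \<omega>] by auto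
    have "mix_coeff \<eta> \<eta>' (T k \<omega>) (T (Suc k) \<omega>) = mix_coeff (\<lambda>_. c) (\<lambda>_. c) (T k \<omega>) (T (Suc k) \<omega>)"
      "mix_coeff' \<eta> \<eta>' (T k \<omega>) (T (Suc k) \<omega>) = mix_coeff' (\<lambda>_. c) (\<lambda>_. c) (T k \<omega>) (T (Suc k) \<omega>)"
      using rates par ab by (auto intro!: mix_coeff_cong simp: mixing_rate_def c_def)
    with mix_coeff_const[OF c ab(2)] par ab show ?thesis by auto
  qed
  then show "\<omega> \<in> space M \<Longrightarrow>
      mix_coeff \<eta> \<eta>' (T k \<omega>) (T (Suc k) \<omega>) = 1 / 2 * (1 - exp (- 2 * sqrt (\<mu> / L) * (T (Suc k) \<omega> - T k \<omega>))) \<and>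
      mix_coeff' \<eta> \<eta>' (T k \<omega>) (T (Suc k) \<omega>) = tanh (sqrt (\<mu> / L) * (T (Suc k) \<omega> - T k \<omega>)) \<and>
      \<gamma> (T (Suc k) \<omega>) = 1 / L \<and> \<gamma>' (T (Suc k) \<omega>) = 1 / sqrt (\<mu> * L)" for k \<omega>
    unfolding c_def .
  note [measurable] = continuized_value_measurable[OF T f proc] Tf(5)
  let ?F = "nesterov_step f (\<lambda>s t. 1 / 2 * (1 - exp (- 2 * c * (t - s)))) (\<lambda>s t. tanh (c * (t - s)))
      (\<lambda>_. 1 / L) (\<lambda>_. 1 / sqrt (\<mu> * L))"
  \<comment> \<open>This discharges the side condition under which the recursion for
    \<open>z\<close> holds.\<close>
  have pos: "\<forall>t>0. \<eta>' t \<ge> 0" using par \<mu> L by auto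
  have evol: "AE \<omega> in M. x 0 \<omega> = x0 \<and> z 0 \<omega> = z0 \<and> (\<forall>k.
      (T (Suc k) \<omega>, x (T (Suc k) \<omega>) \<omega>, z (T (Suc k) \<omega>) \<omega>)
        = ?F (T k \<omega>, x (T k \<omega>) \<omega>, z (T k \<omega>) \<omega>) (T (Suc k) \<omega> - T k \<omega>))"
    using continuized_step[OF T rates proc] AE_space
  proof eventually_elim
    case (elim \<omega>)
    then show ?case using coeff[OF elim(2)] pos by (simp add: nesterov_step_def Let_def)
  qed
  have "continuous_on UNIV f"
    using f by (simp add: continuous_on_eq_continuous_at differentiable_imp_continuous_within)
  then have [measurable]: "f \<in> borel_measurable borel" by (rule borel_measurable_continuous_onI)
  have \<Phi>: "lyapunov_strong f c \<mu> xs \<in> borel_measurable (borel \<Otimes>\<^sub>M borel \<Otimes>\<^sub>M borel)"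
    unfolding lyapunov_strong_def case_prod_beta' by measurable
  have tanh: "case_prod (\<lambda>s t. tanh (c * (t - s))) \<in> borel_measurable (borel \<Otimes>\<^sub>M borel)"
    unfolding tanh_real_altdef case_prod_beta' by measurable
  have "(\<integral>\<^sup>+\<omega>. ennreal (lyapunov_strong f c \<mu> xs (T k \<omega>, x (T k \<omega>) \<omega>, z (T k \<omega>) \<omega>)) \<partial>M)
      \<le> ennreal (lyapunov_strong f c \<mu> xs (0, x0, z0))"
  proof (rule nn_integral_lyapunov_le[where \<tau> = "\<lambda>s t. 1 / 2 * (1 - exp (- 2 * c * (t - s)))"
        and \<tau>' = "\<lambda>s t. tanh (c * (t - s))" and \<gamma> = "\<lambda>_. 1 / L" and \<gamma>' = "\<lambda>_. 1 / sqrt (\<mu> * L)",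
        OF T f _ tanh _ _ \<Phi> evol])
    show "(\<lambda>(s, t). 1 / 2 * (1 - exp (- 2 * c * (t - s)))) \<in> borel_measurable (borel \<Otimes>\<^sub>M borel)"
      unfolding case_prod_beta' by measurable
  qed (rule borel_measurable_const lyapunov_strong_step[OF strong f L \<mu> min c_def])+
  then have *: "(\<integral>\<^sup>+\<omega>. ennreal (lyapunov_strong f c \<mu> xs (T k \<omega>, x (T k \<omega>) \<omega>, z (T k \<omega>) \<omega>)) \<partial>M)
      \<le> ennreal (f x0 - f xs + \<mu> / 2 * (norm (z0 - xs))\<^sup>2)"
    by (simp add: lyapunov_strong_def)
  have "0 \<le> f x0 - f xs + \<mu> / 2 * (norm (z0 - xs))\<^sup>2" using min[of x0] \<mu> by simp
  then have "integrable M (\<lambda>\<omega>. exp (c * T k \<omega>) * (f (x (T k \<omega>) \<omega>) - f xs)) \<and>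
    (\<integral>\<omega>. exp (c * T k \<omega>) * (f (x (T k \<omega>) \<omega>) - f xs) \<partial>M) \<le> f x0 - f xs + \<mu> / 2 * (norm (z0 - xs))\<^sup>2"
    by (intro conjI; intro integral_le_of_nn_integral_le[OF _ _ _ *])
      (use min \<mu> in \<open>auto simp: lyapunov_strong_def intro!: mult_left_mono\<close>)
  then show "integrable M (\<lambda>\<omega>. exp (sqrt (\<mu> / L) * T k \<omega>) * (f (x (T k \<omega>) \<omega>) - f xs))"
    "(\<integral>\<omega>. exp (sqrt (\<mu> / L) * T k \<omega>) * (f (x (T k \<omega>) \<omega>) - f xs) \<partial>M)
      \<le> f x0 - f xs + \<mu> / 2 * (norm (z0 - xs))\<^sup>2"
    by (simp_all add: c_def)
qed

text \<open>Quantifying the four coefficient functions before \<open>f\<close>, \<open>L\<close>,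
  the probability space and the process makes them functions of the rates and of two consecutive
  jump times. The side condition on the third recursion reflects a true obstruction: for negative
  \<open>\<eta>'\<close> the component \<open>z\<close> can move although \<open>y\<close> ends at
  the starting point of \<open>z\<close>, and then no multiple of their difference accounts for
  it.\<close>

theorem theorem3:
  shows "\<exists>\<tau> \<tau>' \<sigma> \<sigma>' :: (real \<Rightarrow> real) \<Rightarrow> (real \<Rightarrow> real) \<Rightarrow> (real \<Rightarrow> real) \<Rightarrow> (real \<Rightarrow> real) \<Rightarrow> real \<Rightarrow> real \<Rightarrow> real.
    \<forall>(f :: 'a::euclidean_space \<Rightarrow> real) L xs (M :: 'w measure) T \<eta> \<eta>' \<gamma> \<gamma>' x0 z0 x z.
      convex_on UNIV f \<and> (\<forall>y. f differentiable (at y)) \<and> L > 0 \<and> L_smooth L f \<and> (\<forall>y. f xs \<le> f y) \<and>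
      poisson_times M T \<and>
      mixing_rate \<eta> \<and> mixing_rate \<eta>' \<and> \<gamma> \<in> borel_measurable borel \<and> \<gamma>' \<in> borel_measurable borel \<and>
      continuized_process M T f \<eta> \<eta>' \<gamma> \<gamma>' x0 z0 x z \<longrightarrow>
      (let xt = (\<lambda>k \<omega>. x (T k \<omega>) \<omega>);
           yt = (\<lambda>k \<omega>. left_lim (\<lambda>t. x t \<omega>) (T (Suc k) \<omega>));
           zt = (\<lambda>k \<omega>. z (T k \<omega>) \<omega>);
           tau = (\<lambda>k \<omega>. \<tau> \<eta> \<eta>' \<gamma> \<gamma>' (T k \<omega>) (T (Suc k) \<omega>));
           tau' = (\<lambda>k \<omega>. \<tau>' \<eta> \<eta>' \<gamma> \<gamma>' (T k \<omega>) (T (Suc k) \<omega>));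
           gam = (\<lambda>k \<omega>. \<sigma> \<eta> \<eta>' \<gamma> \<gamma>' (T k \<omega>) (T (Suc k) \<omega>));
           gam' = (\<lambda>k \<omega>. \<sigma>' \<eta> \<eta>' \<gamma> \<gamma>' (T k \<omega>) (T (Suc k) \<omega>))
       in
        (\<forall>k. tau k \<in> borel_measurable M \<and> tau' k \<in> borel_measurable M \<and>
             gam k \<in> borel_measurable M \<and> gam' k \<in> borel_measurable M) \<and>
        (AE \<omega> in M. \<forall>k.
           yt k \<omega> = xt k \<omega> + tau k \<omega> *\<^sub>R (zt k \<omega> - xt k \<omega>) \<and>
           xt (Suc k) \<omega> = yt k \<omega> - gam k \<omega> *\<^sub>R grad f (yt k \<omega>) \<and>
           ((\<forall>t>0. \<eta>' t \<ge> 0) \<or> tau k \<omega> \<noteq> 1 \<longrightarrow>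
             zt (Suc k) \<omega> = zt k \<omega> + tau' k \<omega> *\<^sub>R (yt k \<omega> - zt k \<omega>) - gam' k \<omega> *\<^sub>R grad f (yt k \<omega>))) \<and>
        ((\<forall>t>0. \<eta> t = 2 / t \<and> \<eta>' t = 0 \<and> \<gamma> t = 1 / L \<and> \<gamma>' t = t / (2 * L)) \<longrightarrow>
          (\<forall>k. \<forall>\<omega>\<in>space M.
             tau k \<omega> = 1 - (T k \<omega> / T (Suc k) \<omega>)\<^sup>2 \<and> tau' k \<omega> = 0 \<and>
             gam k \<omega> = 1 / L \<and> gam' k \<omega> = T (Suc k) \<omega> / (2 * L)) \<and>
          (\<forall>k. integrable M (\<lambda>\<omega>. (T k \<omega>)\<^sup>2 * (f (xt k \<omega>) - f xs)) \<and>
             (\<integral>\<omega>. (T k \<omega>)\<^sup>2 * (f (xt k \<omega>) - f xs) \<partial>M) \<le> 2 * L * (norm (z0 - xs))\<^sup>2)) \<and>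
        (\<forall>\<mu>>0. strongly_convex \<mu> f \<and>
          (\<forall>t>0. \<eta> t = sqrt (\<mu> / L) \<and> \<eta>' t = sqrt (\<mu> / L) \<and> \<gamma> t = 1 / L \<and> \<gamma>' t = 1 / sqrt (\<mu> * L)) \<longrightarrow>
          (\<forall>k. \<forall>\<omega>\<in>space M.
             tau k \<omega> = 1 / 2 * (1 - exp (- 2 * sqrt (\<mu> / L) * (T (Suc k) \<omega> - T k \<omega>))) \<and>
             tau' k \<omega> = tanh (sqrt (\<mu> / L) * (T (Suc k) \<omega> - T k \<omega>)) \<and>
             gam k \<omega> = 1 / L \<and> gam' k \<omega> = 1 / sqrt (\<mu> * L)) \<and>
          (\<forall>k. integrable M (\<lambda>\<omega>. exp (sqrt (\<mu> / L) * T k \<omega>) * (f (xt k \<omega>) - f xs)) \<and>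
             (\<integral>\<omega>. exp (sqrt (\<mu> / L) * T k \<omega>) * (f (xt k \<omega>) - f xs) \<partial>M)
               \<le> f x0 - f xs + \<mu> / 2 * (norm (z0 - xs))\<^sup>2)))"
proof (rule exI[of _ "\<lambda>\<eta> \<eta>' \<gamma> \<gamma>'. mix_coeff \<eta> \<eta>'"], rule exI[of _ "\<lambda>\<eta> \<eta>' \<gamma> \<gamma>'. mix_coeff' \<eta> \<eta>'"],
    rule exI[of _ "\<lambda>\<eta> \<eta>' \<gamma> \<gamma>' s. \<gamma>"], rule exI[of _ "\<lambda>\<eta> \<eta>' \<gamma> \<gamma>' s. \<gamma>'"], intro allI impI, goal_cases)
  case (1 f L xs M T \<eta> \<eta>' \<gamma> \<gamma>' x0 z0 x z)
  then have conv: "convex_on UNIV f" and f: "\<And>y. f differentiable (at y)" and L: "L > 0" "L_smooth L f"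
    and min: "\<And>y. f xs \<le> f y" and T: "poisson_times M T" and rates: "mixing_rate \<eta>" "mixing_rate \<eta>'"
    and \<gamma>: "\<gamma> \<in> borel_measurable borel" "\<gamma>' \<in> borel_measurable borel"
    and proc: "continuized_process M T f \<eta> \<eta>' \<gamma> \<gamma>' x0 z0 x z"
    by blast+
  have \<eta>: "\<eta> \<in> borel_measurable borel" "\<eta>' \<in> borel_measurable borel"
    using rates by (auto simp: mixing_rate_def)
  note Tm = poisson_times_facts(5)[OF T]
  have meas: "\<forall>k. (\<lambda>\<omega>. mix_coeff \<eta> \<eta>' (T k \<omega>) (T (Suc k) \<omega>)) \<in> borel_measurable M \<and>
      (\<lambda>\<omega>. mix_coeff' \<eta> \<eta>' (T k \<omega>) (T (Suc k) \<omega>)) \<in> borel_measurable M \<and>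
      (\<lambda>\<omega>. \<gamma> (T (Suc k) \<omega>)) \<in> borel_measurable M \<and> (\<lambda>\<omega>. \<gamma>' (T (Suc k) \<omega>)) \<in> borel_measurable M"
    using borel_measurable_mix_coeff[OF \<eta> Tm Tm] measurable_compose[OF Tm \<gamma>(1)] measurable_compose[OF Tm \<gamma>(2)]
    by blast
  note step = continuized_step[OF T rates proc]
  note rate1 = continuized_convex_rate[OF T rates proc conv f L min]
  note rate2 = continuized_strongly_convex_rate[OF T rates proc _ _ f L min]
  show ?case
    unfolding Let_def
    using meas step rate1 rate2 by (intro conjI allI impI) (blast | (elim AE_mp; blast))+
qed

end
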